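(* Let $n\ge 1$ be an integer and let $m=\prod_{i=1}^s p_i^{\alpha_i}$, where $s\ge 1$, $p_1<p_2<\cdots<p_s$ are odd primes and all $\alpha_i$ are positive integers. (a) There is no $(m,n)$-generalized bent function when $s=1$. (b) There is no $(m,n)$-generalized bent function if $s\ge 2$ and $3p_1+p_2>2^n$. (c) Suppose that $p_{r+1}$ is the smallest prime among $p_1,\dots,p_s$ such that $p_1+p_{r+1}>2^n$. If there is no $\left(\prod_{i=1}^r p_i^{\alpha_i},n\right)$-generalized bent function, then there is no $(m,n)$-generalized bent function.
   Context: For positive integers $m$ and $n$, put $\zeta_m=e^{2\pi\sqrt{-1}/m}$. A function $f:\mathbb{Z}_2^n\to\mathbb{Z}_m$ (where $\mathbb{Z}_m=\mathbb{Z}/m\mathbb{Z}$) is called an $(m,n)$-generalized bent function ($(m,n)$-GBF) if $|F(y)|^2=2^n$ for all $y\in\mathbb{Z}_2^n$, where $F(y)=\sum_{x\in\mathbb{Z}_2^n}\zeta_m^{f(x)}(-1)^{y\cdot x}$ and $y\cdot x$ is the usual inner product. When $r=0$ in (c), the empty product equals $1$ and the definition is read with $m=1$ (so $\zeta_1=1$). *)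

theory Defs
  imports
    Complex_Main
    "HOL-Computational_Algebra.Primes"
    "HOL-Library.FuncSet"
    "HOL-Library.Z2"
    "Jordan_Normal_Form.Matrix"
begin

definition zeta :: "nat \<Rightarrow> complex" where
  "zeta m = exp (2 * complex_of_real pi * \<i> / of_nat m)"

text \<open>
  The elements of $\mathbb{Z}_2^n$ are the vectors of dimension \<open>n\<close> over the two-element
  field \<^typ>\<open>bit\<close>, and the elements of $\mathbb{Z}_m$ are represented by their least
  nonnegative residues \<open>0, \<dots>, m - 1\<close>.
\<close>

definition gbf_transform :: "nat \<Rightarrow> nat \<Rightarrow> (bit vec \<Rightarrow> nat) \<Rightarrow> bit vec \<Rightarrow> complex" where
  "gbf_transform m n f y =
    (\<Sum>x\<in>carrier_vec n. zeta m ^ f x * (- 1) ^ of_bit (scalar_prod y x))"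

definition is_gbf :: "nat \<Rightarrow> nat \<Rightarrow> (bit vec \<Rightarrow> nat) \<Rightarrow> bool" where
  "is_gbf m n f \<longleftrightarrow>
    f \<in> carrier_vec n \<rightarrow> {..<m} \<and>
    (\<forall>y\<in>carrier_vec n. (cmod (gbf_transform m n f y))\<^sup>2 = 2 ^ n)"

end

theory Submission
  imports Defs "Jordan_Normal_Form.Char_Poly" "HOL-Number_Theory.Residues"
begin

text \<open>
  Put \<open>w x = zeta m ^ f x\<close>. Then \<open>f\<close> is generalized bent iff for every \<open>a \<noteq> 0\<close> the multiset of
  the \<open>2 ^ n\<close> ratios \<open>w x / w (x + a)\<close>, which is closed under inversion, has sum \<open>0\<close>. So
  everything rests on vanishing sums of roots of unity of odd order \<open>m\<close>. For a prime \<open>q\<close> dividing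
  \<open>m = q * k\<close>, cut such a multiset along the cosets of the \<open>k\<close>-th roots of unity into \<open>q\<close> slices:
  irreducibility of the cyclotomic polynomials forces all slices to have the same sum, and this
  sum is \<open>0\<close> if \<open>q\<close> divides \<open>k\<close>. A parity count on the slice sizes then does the rest.
  (a) For a prime power \<open>m\<close> the size of a vanishing sum is a multiple of the prime.
  (b) A vanishing sum of even size less than \<open>3 * p\<^sub>1 + p\<^sub>2\<close>, not a multiple of \<open>p\<^sub>1\<close>, is the union
  of two rotated regular polygons with a prime number of vertices. By symmetry the rotations are
  trivial here, so any two values of \<open>w\<close> differ by a factor of prime order, all factors lie in
  a single group of prime order, and (a) applies.
  (c) If \<open>p\<^sub>1 + q > 2 ^ n\<close> and \<open>m = q ^ e * k\<close> with \<open>k\<close> prime to \<open>q\<close>, then all slices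
  sum to \<open>0\<close>, recursively, and hence \<open>w ^ t\<close> is again bent, for \<open>t\<close> congruent to \<open>0\<close> modulo
  \<open>q ^ e\<close> and to \<open>1\<close> modulo \<open>k\<close>.
\<close>

section \<open>Integer relations between powers of a root of unity\<close>

text \<open>The obstacle is that -1 has even order, so no term can be cancelled by another one.
  Where slices have to be subtracted, either two multisets with equal sum are kept, or a term
  \<open>a\<close> is cancelled by the other vertices of a \<open>p\<close>-gon through
  \<open>a\<close>, which gives back a vanishing sum to which a classification applies. Slices have
  equal sums because z |-> z^t, for \<open>t\<close> coprime to \<open>m\<close> and congruent to 1
  modulo \<open>k\<close>, preserves all relations, fixes the \<open>k\<close>-th roots of unity and
  moves only the coset representatives; Fourier inversion over the \<open>q\<close> cosets does the
  rest. The residue 0 modulo \<open>q\<close> is missing among these \<open>t\<close>, hence the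
  common constant when \<open>q\<close> does not divide \<open>k\<close>. The bound in (b) is the
  size of three \<open>p_1\<close>-gons and one \<open>p_2\<close>-gon: below it, a union of four or
  more polygons, even in number, consists of \<open>p_1\<close>-gons only, and its size is a
  multiple of \<open>p_1\<close>, so no power of two. In the same way 2 p_1 + p_2 bounds the odd
  sizes. In (c), p_1 + q is the least size of a union of evenly many polygons one of which is a
  \<open>q\<close>-gon.\<close>

definition int_adjoin :: "complex \<Rightarrow> complex set" where
  "int_adjoin z = range (\<lambda>c::int poly. poly (of_int_poly c) z)"

lemma int_adjoin_add: "x \<in> int_adjoin z \<Longrightarrow> y \<in> int_adjoin z \<Longrightarrow> x + y \<in> int_adjoin z"
  unfolding int_adjoin_def by (auto simp flip: poly_add of_int_poly_hom.hom_add)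

lemma int_adjoin_mult: "x \<in> int_adjoin z \<Longrightarrow> y \<in> int_adjoin z \<Longrightarrow> x * y \<in> int_adjoin z"
  unfolding int_adjoin_def by (auto simp flip: poly_mult of_int_poly_hom.hom_mult)

lemma int_adjoin_of_int: "of_int i \<in> int_adjoin z"
  unfolding int_adjoin_def by (rule range_eqI[where x = "[:i:]"]) (simp add: of_int_hom.map_poly_pCons_hom)

lemma int_adjoin_of_nat: "of_nat i \<in> int_adjoin z"
  using int_adjoin_of_int[of "int i"] by simp

lemma int_adjoin_gen: "z \<in> int_adjoin z"
  unfolding int_adjoin_def by (rule range_eqI[where x = "[:0, 1:]"]) simp

lemma int_adjoin_minus: "x \<in> int_adjoin z \<Longrightarrow> - x \<in> int_adjoin z"
  using int_adjoin_mult[OF int_adjoin_of_int[of "-1" z]] by simp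

lemma int_adjoin_diff: "x \<in> int_adjoin z \<Longrightarrow> y \<in> int_adjoin z \<Longrightarrow> x - y \<in> int_adjoin z"
  using int_adjoin_add[OF _ int_adjoin_minus] by simp

lemma int_adjoin_power: "x \<in> int_adjoin z \<Longrightarrow> x ^ k \<in> int_adjoin z"
  using int_adjoin_of_nat[of 1 z] by (induction k) (auto intro: int_adjoin_mult)

lemma int_adjoin_sum: "(\<And>i. i \<in> I \<Longrightarrow> f i \<in> int_adjoin z) \<Longrightarrow> sum f I \<in> int_adjoin z"
  using int_adjoin_of_nat[of 0 z]
  by (induction I rule: infinite_finite_induct) (auto intro: int_adjoin_add)

lemma int_adjoin_poly: "x \<in> int_adjoin z \<Longrightarrow> poly (of_int_poly (c :: int poly)) x \<in> int_adjoin z"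
  using int_adjoin_of_nat[of 0 z]
  by (induction c) (auto intro: int_adjoin_add int_adjoin_mult int_adjoin_of_int simp: of_int_hom.map_poly_pCons_hom)

lemma int_adjoin_root_of_unity_basis:
  assumes "m > 0" "z ^ m = 1" "x \<in> int_adjoin z"
  shows "\<exists>a. x = (\<Sum>j<m. of_int (a j) * z ^ j)"
proof -
  obtain c :: "int poly" where x: "x = poly (of_int_poly c) z"
    using assms(3) by (auto simp: int_adjoin_def)
  have "\<exists>a. poly (of_int_poly c) z = (\<Sum>j<m. of_int (a j) * z ^ j)" for c :: "int poly"
  proof (induction c)
    case 0
    show ?case by (intro exI[of _ "\<lambda>_. 0"]) simp
  next
    case (pCons a0 c)
    then obtain a where a: "poly (of_int_poly c) z = (\<Sum>j<m. of_int (a j) * z ^ j)" by blast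
    obtain m' where m': "m = Suc m'" using assms(1) by (cases m) auto
    \<comment> \<open>Multiplication by \<open>z\<close> shifts all exponents up by one; the top
      coefficient \<open>a m'\<close> returns to exponent 0 because
      \<open>z ^ m = 1\<close>.\<close>
    define b where "b = (\<lambda>j. case j of 0 \<Rightarrow> a0 + a m' | Suc i \<Rightarrow> a i)"
    have "poly (of_int_poly (pCons a0 c)) z = of_int a0 + z * (\<Sum>j<m. of_int (a j) * z ^ j)"
      using a by (simp add: of_int_hom.map_poly_pCons_hom)
    also have "z * (\<Sum>j<m. of_int (a j) * z ^ j) = (\<Sum>j<m'. of_int (a j) * z ^ Suc j) + of_int (a m') * z ^ m"
      by (simp add: m' sum_distrib_left algebra_simps)
    also have "of_int a0 + \<dots> = of_int (a0 + a m') + (\<Sum>j<m'. of_int (a j) * z ^ Suc j)"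
      using assms(2) by simp
    also have "\<dots> = (\<Sum>j<m. of_int (b j) * z ^ j)"
      unfolding m' sum.lessThan_Suc_shift by (simp add: b_def)
    finally show ?case by blast
  qed
  then show ?thesis using x by blast
qed

text \<open>Multiplication by \<open>x\<close> takes each \<open>z ^ i\<close> to an integer
  combination of the \<open>m\<close> powers of \<open>z\<close>. So \<open>x\<close> is an
  eigenvalue of an integer matrix, with the vector of powers as eigenvector, and a root of its monic
  characteristic polynomial.\<close>

lemma int_adjoin_root_of_unity_algebraic_int:
  assumes "m > 0" "z ^ m = 1" "x \<in> int_adjoin z"
  shows "algebraic_int x"
proof -
  have "\<exists>a. x * z ^ i = (\<Sum>j<m. of_int (a j) * z ^ j)" for i
    by (intro int_adjoin_root_of_unity_basis assms int_adjoin_mult int_adjoin_power int_adjoin_gen)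
  then obtain a where a: "\<And>i. x * z ^ i = (\<Sum>j<m. of_int (a i j) * z ^ j)" by metis
  define C :: "int mat" where "C = mat m m (\<lambda>(i, j). a i j)"
  have C: "C \<in> carrier_mat m m" "map_mat of_int C \<in> carrier_mat m m" by (auto simp: C_def)
  have "eigenvector (map_mat of_int C) (vec m (\<lambda>i. z ^ i)) x"
    unfolding eigenvector_def
  proof (intro conjI)
    show "vec m (\<lambda>i. z ^ i) \<noteq> 0\<^sub>v (dim_row (map_mat of_int C))"
    proof
      assume "vec m (\<lambda>i. z ^ i) = 0\<^sub>v (dim_row (map_mat of_int C))"
      then have "vec m (\<lambda>i. z ^ i) $ 0 = 0\<^sub>v (dim_row (map_mat of_int C)) $ 0" by simp
      then show False using assms(1) C by simp
    qed
    show "map_mat of_int C *\<^sub>v vec m (\<lambda>i. z ^ i) = x \<cdot>\<^sub>v vec m (\<lambda>i. z ^ i)"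
      by (rule eq_vecI) (auto simp: C_def a scalar_prod_def lessThan_atLeast0)
  qed (use C in auto)
  then have "poly (char_poly (map_mat of_int C)) x = 0"
    using eigenvalue_root_char_poly[OF C(2)] unfolding eigenvalue_def by blast
  then have "poly (of_int_poly (char_poly C)) x = 0"
    using of_int_hom.char_poly_hom[OF C(1)] by metis
  moreover have "lead_coeff (char_poly C) = 1" using degree_monic_char_poly[OF C(1)] by simp
  ultimately show ?thesis unfolding algebraic_int_altdef_ipoly by blast
qed

text \<open>Otherwise 1 / l would be a rational algebraic integer, hence an integer.\<close>

lemma int_adjoin_not_inverse_prime:
  assumes "m > 0" "z ^ m = 1" "prime (l :: nat)" "x \<in> int_adjoin z"
  shows "of_nat l * x \<noteq> 1"
proof
  assume eq: "of_nat l * x = 1"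
  have "l > 0" using assms(3) by (rule prime_gt_0_nat)
  then have x: "x = 1 / of_nat l" using eq by (simp add: field_simps)
  have "x \<in> \<int>"
  proof (rule rational_algebraic_int_is_int)
    show "algebraic_int x" using assms by (intro int_adjoin_root_of_unity_algebraic_int)
    show "x \<in> \<rat>" unfolding x by simp
  qed
  then obtain i where "x = of_int i" by (auto elim: Ints_cases)
  then have "of_int (int l * i) = (1 :: complex)" using eq by simp
  then have "int l * i = 1" by (simp only: of_int_eq_1_iff)
  then show False using assms(3) by (metis int_dvd_int_iff not_prime_unit dvd_triv_left int_one_le_iff_zero_less nat_dvd_1_iff_1 of_nat_1 of_nat_dvd_iff prime_nat_iff)
qed

text \<open>Takes the place of the norm: stripping factors X from an integer polynomial with root
  \<open>x\<close> leaves a nonzero constant term, and that term is a multiple of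
  \<open>x\<close>.\<close>

lemma int_adjoin_divides_int:
  assumes "m > 0" "z ^ m = 1" "x \<in> int_adjoin z" "x \<noteq> 0"
  shows "\<exists>e y. e \<noteq> (0::int) \<and> y \<in> int_adjoin z \<and> of_int e = x * y"
proof -
  have "algebraic_int x" using assms by (intro int_adjoin_root_of_unity_algebraic_int)
  then obtain P :: "int poly" where "poly (of_int_poly P) x = 0" "lead_coeff P = 1"
    unfolding algebraic_int_altdef_ipoly by blast
  then have "P \<noteq> 0" "poly (of_int_poly P) x = 0" by auto
  then show ?thesis
  proof (induction P)
    case (pCons a P)
    show ?case
    proof (cases "a = 0")
      case True
      then have "poly (of_int_poly P) x = 0" "P \<noteq> 0"
        using pCons.prems assms(4) by (auto simp: of_int_hom.map_poly_pCons_hom)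
      then show ?thesis using pCons.IH by blast
    next
      case False
      have "of_int a = x * - poly (of_int_poly P) x"
        using pCons.prems by (simp add: of_int_hom.map_poly_pCons_hom eq_neg_iff_add_eq_0)
      then show ?thesis using False int_adjoin_minus[OF int_adjoin_poly[OF assms(3)]] by blast
    qed
  qed simp
qed

text \<open>If \<open>l\<close> did not divide \<open>e\<close>, a Bezout combination of the two
  would make \<open>l\<close> invertible in \<open>int_adjoin z\<close>.\<close>

lemma int_adjoin_prime_dvd:
  assumes "m > 0" "z ^ m = 1" "prime (l :: nat)" "x \<in> int_adjoin z" "of_int e = of_nat l * x"
  shows "int l dvd e"
proof (rule ccontr)
  assume "\<not> int l dvd e"
  then have "coprime (int l) e" using assms(3) by (simp add: prime_imp_coprime)
  then obtain u v where "u * int l + v * e = 1"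
    by (metis bezout_int coprime_iff_gcd_eq_1)
  then have "of_int u * of_nat l + of_int v * of_int e = (1::complex)"
    by (metis of_int_1 of_int_add of_int_mult of_int_of_nat_eq)
  then have "of_nat l * (of_int u + of_int v * x) = 1" using assms(5) by (simp add: algebra_simps)
  moreover have "of_int u + of_int v * x \<in> int_adjoin z"
    using assms(4) by (intro int_adjoin_add int_adjoin_mult int_adjoin_of_int)
  ultimately show False using int_adjoin_not_inverse_prime assms by blast
qed

section \<open>Frobenius congruences and conjugation of relations\<close>

lemma frobenius_int_adjoin:
  assumes "prime (l :: nat)" "x \<in> int_adjoin z" "y \<in> int_adjoin z"
  shows "\<exists>w\<in>int_adjoin z. (x + y) ^ l = x ^ l + y ^ l + of_nat l * w"
proof -
  have l: "l > 0" "l \<noteq> 0" using assms(1) prime_gt_0_nat by auto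
  have "(x + y) ^ l = (\<Sum>k\<le>l. of_nat (l choose k) * x ^ k * y ^ (l - k))" by (rule binomial_ring)
  also have "{..l} = insert 0 (insert l {0<..<l})" using l by auto
  also have "(\<Sum>k\<in>\<dots>. of_nat (l choose k) * x ^ k * y ^ (l - k)) =
      x ^ l + y ^ l + (\<Sum>k\<in>{0<..<l}. of_nat (l choose k) * x ^ k * y ^ (l - k))"
    using l by simp
  also have "(\<Sum>k\<in>{0<..<l}. of_nat (l choose k) * x ^ k * y ^ (l - k)) =
      of_nat l * (\<Sum>k\<in>{0<..<l}. of_nat ((l choose k) div l) * x ^ k * y ^ (l - k))"
    unfolding sum_distrib_left
  proof (rule sum.cong, goal_cases)
    case (2 k)
    then have "l dvd (l choose k)" using assms(1) by (intro dvd_choose_prime) auto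
    then have "l choose k = l * ((l choose k) div l)" by simp
    then show ?case by (metis (no_types, lifting) mult.assoc of_nat_mult)
  qed simp
  finally show ?thesis
    by (rule bexI) (intro int_adjoin_sum int_adjoin_mult int_adjoin_power int_adjoin_of_nat assms)
qed

lemma fermat_int:
  fixes a :: int
  assumes "prime (l :: nat)"
  shows "[a ^ l = a] (mod int l)"
proof -
  have l: "l > 0" using assms by (rule prime_gt_0_nat)
  define b where "b = nat (a mod int l)"
  have b: "[a = int b] (mod int l)" using l by (simp add: b_def cong_def)
  have "[b ^ l = b] (mod l)"
  proof (cases "l dvd b")
    case True
    then have "l dvd b ^ l" using l by (simp add: dvd_power_iff_le dvd_trans[OF _ dvd_power])
    then show ?thesis using True by (simp add: cong_def mod_eq_0_iff_dvd)
  next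
    case False
    then have "[b ^ (l - 1) * b = 1 * b] (mod l)"
      using fermat_theorem[OF assms] by (intro cong_mult) auto
    then show ?thesis using l by (cases l) (auto simp: mult.commute)
  qed
  then have "[int b ^ l = int b] (mod int l)" by (metis cong_int_iff of_nat_power)
  with b show ?thesis by (meson cong_pow cong_sym cong_trans)
qed

text \<open>Modulo \<open>l\<close> the map x |-> x^l is additive and, by Fermat's little theorem,
  fixes the integer coefficients; so it commutes with evaluating \<open>c\<close>.\<close>

lemma poly_frobenius_int_adjoin:
  assumes "prime (l :: nat)" "x \<in> int_adjoin z"
  shows "\<exists>w\<in>int_adjoin z. poly (of_int_poly c) (x ^ l) = poly (of_int_poly c) x ^ l + of_nat l * w"
proof (induction c)
  case 0
  have "l > 0" using assms(1) prime_gt_0_nat by auto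
  then show ?case using int_adjoin_of_nat[of 0 z] by (intro bexI[of _ 0]) auto
next
  case (pCons a c)
  then obtain w where w: "w \<in> int_adjoin z"
    "poly (of_int_poly c) (x ^ l) = poly (of_int_poly c) x ^ l + of_nat l * w" by blast
  have "[a ^ l = a] (mod int l)" using assms(1) by (rule fermat_int)
  then obtain b where b: "a ^ l = a + int l * b"
    by (metis cong_iff_lin cong_sym mult.commute)
  obtain v where v: "v \<in> int_adjoin z" "(of_int a + x * poly (of_int_poly c) x) ^ l
      = of_int a ^ l + (x * poly (of_int_poly c) x) ^ l + of_nat l * v"
    using frobenius_int_adjoin[OF assms(1) int_adjoin_of_int int_adjoin_mult[OF assms(2) int_adjoin_poly[OF assms(2)]]] by blast
  have "of_int a ^ l = (of_int a + of_nat l * of_int b :: complex)"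
    using arg_cong[OF b, of "of_int :: int \<Rightarrow> complex"] by simp
  then have "poly (of_int_poly (pCons a c)) (x ^ l) = poly (of_int_poly (pCons a c)) x ^ l
      + of_nat l * (x ^ l * w - of_int b - v)"
    using v w by (simp add: of_int_hom.map_poly_pCons_hom power_mult_distrib algebra_simps)
  moreover have "x ^ l * w - of_int b - v \<in> int_adjoin z"
    using v w assms by (intro int_adjoin_diff int_adjoin_mult int_adjoin_power int_adjoin_of_int)
  ultimately show ?case by blast
qed

lemma root_of_unity_power_mod:
  fixes z :: complex
  assumes "z ^ m = 1"
  shows "z ^ (k mod m) = z ^ k"
proof -
  have "z ^ k = z ^ (m * (k div m) + k mod m)" by simp
  also have "\<dots> = z ^ (k mod m)" using assms by (simp only: power_add power_mult) simp
  finally show ?thesis by simp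
qed

text \<open>Landau's argument: \<open>c (z ^ (k * l))\<close> is divisible by \<open>l\<close> in \<open>\<int>[z]\<close>,
  yet takes only finitely many values.\<close>
lemma poly_root_of_unity_large_prime:
  fixes c :: "int poly" and z :: complex
  assumes "m > 0" "z ^ m = 1"
  shows "\<exists>B. \<forall>(l::nat) (k::nat). prime l \<longrightarrow> l > B \<longrightarrow> poly (of_int_poly c) (z ^ k) = 0 \<longrightarrow>
    poly (of_int_poly c) (z ^ (k * l)) = 0"
proof -
  let ?c = "\<lambda>k. poly (of_int_poly c) (z ^ k)"
  have R: "?c k \<in> int_adjoin z" for k :: nat
    by (intro int_adjoin_poly int_adjoin_power int_adjoin_gen)
  \<comment> \<open>Where \<open>c\<close> does not vanish at \<open>z ^ k\<close>, the integer is a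
    nonzero multiple of its value there; elsewhere 1 serves as a default.\<close>
  have "\<exists>e. e \<noteq> (0::int) \<and> (?c k \<noteq> 0 \<longrightarrow> (\<exists>y\<in>int_adjoin z. of_int e = ?c k * y))" for k :: nat
    using int_adjoin_divides_int[OF assms R[of k]] by (cases "?c k = 0") (auto intro: exI[of _ 1])
  then obtain e where e: "\<And>k. e k \<noteq> (0::int)"
    "\<And>k. ?c k \<noteq> 0 \<Longrightarrow> \<exists>y\<in>int_adjoin z. of_int (e k) = ?c k * y" by metis
  \<comment> \<open>If \<open>c\<close> vanishes at \<open>z ^ k\<close>, Frobenius makes its value
    at \<open>z ^ (k * l)\<close> a multiple of \<open>l\<close>, so \<open>l\<close> divides the
    integer attached to that value. A prime above \<open>B\<close> is too large for this; exponents
    only matter modulo \<open>m\<close>.\<close>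
  define B where "B = (\<Sum>k<m. nat \<bar>e k\<bar>)"
  show ?thesis
  proof (intro exI[of _ B] allI impI, rule ccontr)
    fix l k :: nat
    assume l: "prime l" "l > B" and k: "?c k = 0" and nz: "?c (k * l) \<noteq> 0"
    define j where "j = (k * l) mod m"
    have j: "j < m" "z ^ (k * l) = z ^ j"
      using assms by (auto simp: j_def root_of_unity_power_mod)
    obtain y where y: "y \<in> int_adjoin z" "of_int (e j) = ?c (k * l) * y"
      using e(2)[of j] nz j by auto
    obtain w where w: "w \<in> int_adjoin z" "?c (k * l) = ?c k ^ l + of_nat l * w"
      using poly_frobenius_int_adjoin[OF l(1) int_adjoin_power[of z z k, OF int_adjoin_gen]]
      unfolding power_mult by blast
    have "of_int (e j) = of_nat l * (w * y)"
      using y w k l(1) by (simp add: prime_gt_0_nat mult.assoc)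
    then have "int l dvd e j"
      by (rule int_adjoin_prime_dvd[OF assms l(1) int_adjoin_mult[OF w(1) y(1)]])
    then have "int l \<le> \<bar>e j\<bar>" using e(1)[of j] dvd_imp_le_int[of "e j" "int l"] by simp
    moreover have "nat \<bar>e j\<bar> \<le> B" unfolding B_def
      by (rule member_le_sum) (use j in auto)
    ultimately show False using l(2) by linarith
  qed
qed

text \<open>The form in which irreducibility of the cyclotomic polynomials enters. Since
  \<open>t\<close> matters only modulo \<open>m\<close>, it is replaced by a product of large
  primes, which are applied one after another.\<close>

lemma poly_root_of_unity_conjugate:
  fixes c :: "int poly" and z :: complex and t :: nat
  assumes "m > 0" "z ^ m = 1" "poly (of_int_poly c) z = 0" "coprime t m"
  shows "poly (of_int_poly c) (z ^ t) = 0"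
proof (cases "t = 0")
  case True
  then show ?thesis using assms by simp
next
  case t0: False
  obtain B where B: "\<And>(l::nat) (k::nat). prime l \<Longrightarrow> l > B \<Longrightarrow> poly (of_int_poly c) (z ^ k) = 0 \<Longrightarrow>
    poly (of_int_poly c) (z ^ (k * l)) = 0"
    using poly_root_of_unity_large_prime[OF assms(1,2), of c] by blast
  define S where "S = {l. prime l \<and> l \<le> B \<and> \<not> l dvd t}"
  have S: "finite S" unfolding S_def by auto
  \<comment> \<open>Each prime up to \<open>B\<close> divides exactly one of the two summands, hence
    not \<open>t'\<close>; a prime that divides \<open>t\<close> does not divide \<open>m\<close> by
    coprimality.\<close>
  define t' where "t' = t + m * \<Prod>S"
  have large: "l > B" if "prime l" "l dvd t'" for l
  proof (rule ccontr)
    assume "\<not> l > B"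
    then have "l \<le> B" by simp
    show False
    proof (cases "l dvd t")
      case True
      then have "\<not> l dvd m" using that assms(4)
        by (meson coprime_common_divisor not_prime_unit)
      moreover have "l dvd m * \<Prod>S" using that True by (simp add: t'_def dvd_add_right_iff)
      ultimately have "l dvd \<Prod>S" using that by (simp add: prime_dvd_mult_iff)
      then obtain s where "s \<in> S" "l dvd s" using \<open>prime l\<close> S prime_dvd_prod_iff[of S l "\<lambda>x. x"] by blast
      then show False using True that(1) unfolding S_def by (metis mem_Collect_eq primes_dvd_imp_eq)
    next
      case False
      then have "l \<in> S" using that \<open>l \<le> B\<close> by (simp add: S_def)
      then have "l dvd \<Prod>S" using S dvd_prodI[of S l "\<lambda>x. x"] by simp
      then show False using False that by (simp add: t'_def dvd_add_left_iff)
    qed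
  qed
  have "poly (of_int_poly c) (z ^ (k * n)) = 0"
    if "n \<noteq> 0" "\<forall>l. prime l \<longrightarrow> l dvd n \<longrightarrow> l > B" "poly (of_int_poly c) (z ^ k) = 0" for n k :: nat
    using that
  proof (induction n arbitrary: k rule: prime_divisors_induct)
    case (factor l n)
    have "poly (of_int_poly c) (z ^ ((k * l) * n)) = 0"
      using factor by (intro factor.IH) (auto intro: B)
    then show ?case by (simp add: mult.assoc)
  qed auto
  from this[of t' 1] large t0 assms(3) have "poly (of_int_poly c) (z ^ t') = 0"
    by (auto simp: t'_def)
  also have "z ^ t' = z ^ t" using assms by (simp add: t'_def power_add power_mult)
  finally show ?thesis .
qed

section \<open>Slices along cosets of roots of unity\<close>

definition unity_mset :: "nat \<Rightarrow> complex multiset \<Rightarrow> bool" where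
  "unity_mset m A \<longleftrightarrow> (\<forall>z\<in>#A. z ^ m = 1)"

text \<open>A single polynomial serves all exponents \<open>t\<close>, so replacing the primitive
  root by its \<open>t\<close>-th power turns a relation between the terms into one between their
  \<open>t\<close>-th powers.\<close>

lemma unity_mset_poly:
  assumes "m > 0" "unity_mset m A"
  shows "\<exists>c. \<forall>t. (\<Sum>z\<in>#A. z ^ t) = poly (of_int_poly (c :: int poly)) (cis (2 * pi / m) ^ t)"
  using assms(2)
proof (induction A)
  case empty
  show ?case by (intro exI[of _ 0]) simp
next
  case (add z A)
  then obtain c where c: "\<And>t. (\<Sum>z\<in>#A. z ^ t) = poly (of_int_poly (c :: int poly)) (cis (2 * pi / m) ^ t)"
    by (auto simp: unity_mset_def)
  have "z \<in> (\<lambda>k. cis (2 * pi * real k / real m)) ` {..<m}"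
    using bij_betw_roots_unity[OF assms(1)] add.prems by (auto simp: bij_betw_def unity_mset_def)
  then obtain k where "z = cis (2 * pi * real k / real m)" by auto
  then have "z = cis (2 * pi / m) ^ k" by (simp add: DeMoivre algebra_simps)
  then have "z ^ t = poly (of_int_poly (Polynomial.monom 1 k)) (cis (2 * pi / m) ^ t)" for t
    by (simp add: poly_monom mult.commute flip: power_mult)
  then have "(\<Sum>z\<in>#add_mset z A. z ^ t) = poly (of_int_poly (Polynomial.monom 1 k + c)) (cis (2 * pi / m) ^ t)" for t
    using c by (simp add: of_int_poly_hom.hom_add)
  then show ?case by blast
qed

lemma unity_mset_conjugate:
  fixes t :: nat
  assumes "m > 0" "unity_mset m A" "unity_mset m B" "\<Sum>\<^sub># A = \<Sum>\<^sub># B" "coprime t m"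
  shows "(\<Sum>z\<in>#A. z ^ t) = (\<Sum>z\<in>#B. z ^ t)"
proof -
  obtain a where a: "\<And>t. (\<Sum>z\<in>#A. z ^ t) = poly (of_int_poly (a :: int poly)) (cis (2 * pi / m) ^ t)"
    using unity_mset_poly[OF assms(1,2)] by blast
  obtain b where b: "\<And>t. (\<Sum>z\<in>#B. z ^ t) = poly (of_int_poly (b :: int poly)) (cis (2 * pi / m) ^ t)"
    using unity_mset_poly[OF assms(1,3)] by blast
  have "poly (of_int_poly (a - b)) (cis (2 * pi / m)) = 0"
    using a[of 1] b[of 1] assms(4) by (simp add: of_int_poly_hom.hom_minus)
  moreover have "cis (2 * pi / m) ^ m = 1" using assms(1) by (simp add: DeMoivre)
  ultimately have "poly (of_int_poly (a - b)) (cis (2 * pi / m) ^ t) = 0"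
    using poly_root_of_unity_conjugate assms(1,5) by blast
  then show ?thesis using a[of t] b[of t] by (simp add: of_int_poly_hom.hom_minus)
qed

section \<open>Fourier inversion and coset representatives\<close>

lemma root_of_unity_coprime:
  fixes z :: complex
  assumes "z ^ a = 1" "z ^ b = 1" "coprime a b"
  shows "z = 1"
proof (cases "a = 0")
  case True
  then show ?thesis using assms by simp
next
  case False
  obtain x y where "a * x = b * y + gcd a b" using bezout_nat[OF False] by blast
  then have "z ^ (a * x) = z ^ (b * y) * z" using assms(3) by simp
  then show ?thesis using assms by (simp add: power_mult)
qed

text \<open>The hypotheses say that an invertible Vandermonde matrix annihilates \<open>f\<close>.
  As the \<open>w j\<close> are all the \<open>q\<close>-th roots of unity, inverting it is
  orthogonality: weighting equation \<open>i\<close> by \<open>inverse (w l) ^ i\<close> isolates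
  \<open>f l\<close>.\<close>

lemma fourier_zero:
  fixes f w :: "nat \<Rightarrow> complex"
  assumes "q > 0" "\<And>j. j < q \<Longrightarrow> w j ^ q = 1" "inj_on w {..<q}"
    and "\<And>i. i < q \<Longrightarrow> (\<Sum>j<q. w j ^ i * f j) = 0" and "l < q"
  shows "f l = 0"
proof -
  have nz: "w l \<noteq> 0" using assms(2)[OF assms(5)] assms(1) by (auto simp: power_0_left)
  have "0 = (\<Sum>i<q. inverse (w l) ^ i * (\<Sum>j<q. w j ^ i * f j))" using assms(4) by simp
  also have "\<dots> = (\<Sum>i<q. \<Sum>j<q. (w j / w l) ^ i * f j)"
    by (simp add: sum_distrib_left power_divide power_inverse field_simps)
  also have "\<dots> = (\<Sum>j<q. (\<Sum>i<q. (w j / w l) ^ i) * f j)"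
    by (subst sum.swap) (simp add: sum_distrib_right)
  also have "\<dots> = (\<Sum>j<q. if j = l then of_nat q * f l else 0)"
  proof (intro sum.cong refl)
    fix j assume "j \<in> {..<q}"
    then have j: "j < q" by simp
    show "(\<Sum>i<q. (w j / w l) ^ i) * f j = (if j = l then of_nat q * f l else 0)"
    proof (cases "j = l")
      case True
      then show ?thesis using nz by simp
    next
      case False
      then have "w j / w l \<noteq> 1" using assms(3,5) nz j by (auto simp: inj_on_def)
      moreover have "(w j / w l) ^ q = 1" using assms(2) j assms(5) by (simp add: power_divide)
      ultimately have "(\<Sum>i<q. (w j / w l) ^ i) = 0" by (simp add: geometric_sum)
      then show ?thesis using False by simp
    qed
  qed
  also have "\<dots> = of_nat q * f l" using assms(5) by simp
  finally show ?thesis using assms(1) by simp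
qed

text \<open>Representatives of the cosets of the \<open>k\<close>-th roots of unity in the \<open>q * k\<close>-th
  roots of unity; for \<open>k\<close> prime to \<open>q\<close> they form the group of \<open>q\<close>-th roots of unity.\<close>

definition coset_rep :: "nat \<Rightarrow> nat \<Rightarrow> nat \<Rightarrow> complex" where
  "coset_rep q k j = cis (2 * pi * j / (if q dvd k then q * k else q))"

lemma coset_rep_0 [simp]: "coset_rep q k 0 = 1"
  by (simp add: coset_rep_def)

lemma coset_rep_nonzero [simp]: "coset_rep q k j \<noteq> 0"
  by (simp add: coset_rep_def)

lemma coset_rep_bij:
  assumes "q > 0" "\<not> q dvd k"
  shows "bij_betw (coset_rep q k) {..<q} {z. z ^ q = 1}"
  using bij_betw_roots_unity[OF assms(1)] assms(2) by (simp add: coset_rep_def[abs_def])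

lemma coset_rep_unity:
  assumes "q > 0" "k > 0"
  shows "coset_rep q k j ^ (q * k) = 1"
proof -
  have 1: "cis (2 * pi * real j) = 1" by (rule cis_multiple_2pi) simp
  show ?thesis
  proof (cases "q dvd k")
    case True
    then have "coset_rep q k j ^ (q * k) = cis (2 * pi * real j)"
      using assms by (simp add: coset_rep_def DeMoivre)
    then show ?thesis using 1 by simp
  next
    case False
    then have "coset_rep q k j ^ q = cis (2 * pi * real j)"
      using assms by (simp add: coset_rep_def DeMoivre)
    then show ?thesis using 1 by (simp add: power_mult)
  qed
qed

text \<open>The power \<open>z ^ k\<close> determines the coset of \<open>z\<close> modulo the
  \<open>k\<close>-th roots of unity, so each coset gets exactly one representative. For
  \<open>k\<close> prime to \<open>q\<close>, taking \<open>k\<close>-th powers permutes the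
  \<open>q\<close>-th roots of unity.\<close>

lemma coset_rep_power_bij:
  assumes "prime q" "k > 0"
  shows "bij_betw (\<lambda>j. coset_rep q k j ^ k) {..<q} {z. z ^ q = 1}"
proof -
  have q: "q > 0" using assms(1) by (rule prime_gt_0_nat)
  show ?thesis
  proof (cases "q dvd k")
    case True
    have "coset_rep q k j ^ k = cis (2 * pi * real j / real q)" for j
      using True assms q by (simp add: coset_rep_def DeMoivre)
    then show ?thesis using bij_betw_roots_unity[OF q] by simp
  next
    case False
    then have cop: "coprime k q" using assms(1) by (metis coprime_commute prime_imp_coprime)
    have inj: "inj_on (\<lambda>z::complex. z ^ k) {z. z ^ q = 1}"
    proof (rule inj_onI, clarsimp)
      fix x y :: complex assume xy: "x ^ q = 1" "y ^ q = 1" "x ^ k = y ^ k"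
      then have y: "y \<noteq> 0" using q by (auto simp: power_0_left)
      then have "(x / y) ^ k = 1" "(x / y) ^ q = 1" using xy by (simp_all add: power_divide)
      then have "x / y = 1" using root_of_unity_coprime cop by blast
      then show "x = y" using y by simp
    qed
    have "(\<lambda>z::complex. z ^ k) ` {z. z ^ q = 1} \<subseteq> {z. z ^ q = 1}"
      by clarsimp (metis mult.commute power_mult power_one)
    then have "bij_betw (\<lambda>z::complex. z ^ k) {z. z ^ q = 1} {z. z ^ q = 1}"
      using inj endo_inj_surj[OF finite_roots_unity _ inj] q by (simp add: bij_betw_def)
    from bij_betw_trans[OF coset_rep_bij[OF q False] this] show ?thesis by (simp add: o_def)
  qed
qed

lemma coset_rep_unique:
  assumes "prime q" "k > 0" "z ^ (q * k) = 1"
  shows "\<exists>!j. j < q \<and> (z / coset_rep q k j) ^ k = 1"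
proof -
  have "z ^ k \<in> (\<lambda>j. coset_rep q k j ^ k) ` {..<q}"
    using coset_rep_power_bij[OF assms(1,2)] assms(3) by (simp add: bij_betw_def mult.commute flip: power_mult)
  then have "\<exists>!j. j < q \<and> coset_rep q k j ^ k = z ^ k"
    using coset_rep_power_bij[OF assms(1,2)] by (auto simp: bij_betw_def inj_on_def image_iff)
  moreover have "(z / coset_rep q k j) ^ k = 1 \<longleftrightarrow> coset_rep q k j ^ k = z ^ k" for j
    by (simp add: power_divide divide_eq_1_iff) metis
  ultimately show ?thesis by simp
qed

text \<open>Dividing by the representative makes a slice consist of \<open>k\<close>-th roots of
  unity, so that induction on the order applies to it.\<close>

definition slice :: "nat \<Rightarrow> nat \<Rightarrow> nat \<Rightarrow> complex multiset \<Rightarrow> complex multiset" where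
  "slice q k j A = image_mset (\<lambda>z. z / coset_rep q k j)
     (filter_mset (\<lambda>z. (z / coset_rep q k j) ^ k = 1) A)"

lemma slice_empty [simp]: "slice q k j {#} = {#}"
  by (simp add: slice_def)

lemma unity_mset_slice: "unity_mset k (slice q k j A)"
  by (auto simp: unity_mset_def slice_def)

lemma slice_union: "slice q k j (A + B) = slice q k j A + slice q k j B"
  by (simp add: slice_def)

lemma mset_eq_slices:
  assumes "prime q" "k > 0" "unity_mset (q * k) A"
  shows "A = (\<Sum>j<q. image_mset ((*) (coset_rep q k j)) (slice q k j A))"
  using assms(3)
proof (induction A)
  case empty
  show ?case by (simp add: slice_def)
next
  case (add z A)
  then have z: "z ^ (q * k) = 1" and A: "unity_mset (q * k) A" by (auto simp: unity_mset_def)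
  obtain i where i: "i < q" "(z / coset_rep q k i) ^ k = 1"
    and uniq: "\<And>j. j < q \<Longrightarrow> (z / coset_rep q k j) ^ k = 1 \<Longrightarrow> j = i"
    using coset_rep_unique[OF assms(1,2) z] by blast
  have "(\<Sum>j<q. image_mset ((*) (coset_rep q k j)) (slice q k j {#z#}))
      = (\<Sum>j<q. if j = i then {#z#} else {#})"
  proof (intro sum.cong refl)
    fix j assume "j \<in> {..<q}"
    then have "(z / coset_rep q k j) ^ k = 1 \<longleftrightarrow> j = i" using i uniq[of j] by blast
    then show "image_mset ((*) (coset_rep q k j)) (slice q k j {#z#}) = (if j = i then {#z#} else {#})"
      by (simp add: slice_def)
  qed
  also have "\<dots> = {#z#}" using i by simp
  finally have "(\<Sum>j<q. image_mset ((*) (coset_rep q k j)) (slice q k j {#z#})) = {#z#}" .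
  moreover have "slice q k j (add_mset z A) = slice q k j {#z#} + slice q k j A" for j
    using slice_union[of q k j "{#z#}" A] by simp
  ultimately show ?case using add.IH[OF A] by (simp add: sum.distrib)
qed

lemma sum_slices_power:
  assumes "prime q" "k > 0" "unity_mset (q * k) A"
  shows "(\<Sum>z\<in>#A. z ^ t) = (\<Sum>j<q. coset_rep q k j ^ t * (\<Sum>u\<in>#slice q k j A. u ^ t))"
proof -
  have "(\<Sum>z\<in>#(\<Sum>j\<in>J. image_mset ((*) (coset_rep q k j)) (slice q k j A)). z ^ t)
     = (\<Sum>j\<in>J. coset_rep q k j ^ t * (\<Sum>u\<in>#slice q k j A. u ^ t))" if "finite J" for J
    using that by induction (simp_all add: image_mset.compositionality o_def power_mult_distrib sum_mset_distrib_left)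
  then show ?thesis
    using arg_cong[OF mset_eq_slices[OF assms], of "\<lambda>M. \<Sum>z\<in>#M. z ^ t"] finite_lessThan[of q]
    by (elim trans) simp
qed

lemma size_eq_slices:
  assumes "prime q" "k > 0" "unity_mset (q * k) A"
  shows "size A = (\<Sum>j<q. size (slice q k j A))"
proof -
  have "size (\<Sum>j\<in>J. image_mset ((*) (coset_rep q k j)) (slice q k j A))
     = (\<Sum>j\<in>J. size (slice q k j A))" if "finite J" for J
    using that by induction simp_all
  then show ?thesis
    using arg_cong[OF mset_eq_slices[OF assms], of size] finite_lessThan[of q] by (elim trans) simp
qed

text \<open>An exponent \<open>t\<close> congruent to 1 modulo \<open>k\<close> fixes the slices and
  acts on the representatives only, so each such \<open>t\<close> coprime to \<open>q * k\<close>
  gives a linear equation for the differences \<open>D j\<close>. Two multisets are compared in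
  order to cover relations with negative coefficients.\<close>

theorem slices_sum_const:
  assumes q: "prime q" and k: "k > 0" and A: "unity_mset (q * k) A" and B: "unity_mset (q * k) B"
    and eq: "\<Sum>\<^sub># A = \<Sum>\<^sub># B"
  shows "\<exists>c. (\<forall>j<q. \<Sum>\<^sub># (slice q k j A) - \<Sum>\<^sub># (slice q k j B) = c) \<and> (c = 0 \<or> \<not> q dvd k)"
proof -
  define D where "D j = \<Sum>\<^sub># (slice q k j A) - \<Sum>\<^sub># (slice q k j B)" for j
  have q0: "q > 0" using q by (rule prime_gt_0_nat)
  have conj: "(\<Sum>j<q. coset_rep q k j ^ t * D j) = 0" if t: "coprime t (q * k)" "[t = 1] (mod k)" for t
  proof -
    have pw: "u ^ t = u" if "u ^ k = 1" for u :: complex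
      using that t(2) unfolding cong_def by (metis power_one_right root_of_unity_power_mod)
    have sl: "(\<Sum>u\<in>#slice q k j C. u ^ t) = \<Sum>\<^sub># (slice q k j C)" for j C
    proof -
      have "image_mset (\<lambda>u. u ^ t) (slice q k j C) = image_mset (\<lambda>u. u) (slice q k j C)"
        by (rule image_mset_cong) (use unity_mset_slice[of k q j C] in \<open>auto simp: unity_mset_def pw\<close>)
      then show ?thesis by simp
    qed
    have "(\<Sum>z\<in>#A. z ^ t) = (\<Sum>z\<in>#B. z ^ t)"
      using q0 k A B eq t by (intro unity_mset_conjugate[of "q * k"]) auto
    then show ?thesis
      unfolding sum_slices_power[OF q k A] sum_slices_power[OF q k B] sl D_def
      by (simp add: right_diff_distrib sum_subtractf)
  qed
  show ?thesis
  proof (cases "q dvd k")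
    case True
    have "coset_rep q k j * D j = 0" if j: "j < q" for j
    proof (rule fourier_zero[OF q0 _ _ _ j])
      show "(coset_rep q k j ^ k) ^ q = 1" for j
        using coset_rep_unity[OF q0 k] by (simp add: mult.commute flip: power_mult)
      show "inj_on (\<lambda>j. coset_rep q k j ^ k) {..<q}"
        using coset_rep_power_bij[OF q k] by (simp add: bij_betw_def)
      fix i assume "i < q"
      \<comment> \<open>As \<open>q\<close> divides \<open>k\<close>, being prime to
        \<open>k\<close> is enough; all \<open>q\<close> values of \<open>i\<close> are available
        and the equations force \<open>D\<close> to vanish.\<close>
      have "coprime (1 + k * i) k"
      proof (rule coprimeI)
        fix d assume "d dvd 1 + k * i" "d dvd k"
        then show "is_unit d" by (metis dvd_add_left_iff dvd_mult2)
      qed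
      moreover have "coprime (1 + k * i) q"
        using coprime_divisors[OF dvd_refl True calculation] .
      ultimately have "(\<Sum>j<q. coset_rep q k j ^ (1 + k * i) * D j) = 0"
        by (intro conj) (simp_all only: coprime_mult_right_iff cong_def mod_mult_self2 simp_thms)
      then show "(\<Sum>j<q. (coset_rep q k j ^ k) ^ i * (coset_rep q k j * D j)) = 0"
        by (simp add: power_add power_mult mult.assoc mult.left_commute)
    qed
    then have "\<forall>j<q. D j = 0" by simp
    then show ?thesis unfolding D_def by blast
  next
    case False
    \<comment> \<open>The residues 1, ..., q - 1 modulo \<open>q\<close> are available, but not 0.
      Subtracting the mean supplies the missing equation.\<close>
    define a where "a = (\<Sum>j<q. D j) / of_nat q"
    have "D j - a = 0" if j: "j < q" for j
    proof (rule fourier_zero[OF q0 _ _ _ j])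
      show "coset_rep q k j ^ q = 1" if "j < q" for j
        using coset_rep_bij[OF q0 False] that by (auto simp: bij_betw_def)
      show "inj_on (coset_rep q k) {..<q}"
        using coset_rep_bij[OF q0 False] by (simp add: bij_betw_def)
      fix i assume i: "i < q"
      show "(\<Sum>j<q. coset_rep q k j ^ i * (D j - a)) = 0"
      proof (cases "i = 0")
        case True
        then show ?thesis using q0 by (simp add: sum_subtractf a_def)
      next
        case i0: False
        have cop: "coprime k q" using False q by (metis coprime_commute prime_imp_coprime)
        obtain t where t: "[t = 1] (mod k)" "[t = i] (mod q)"
          using binary_chinese_remainder_nat[OF cop] by blast
        have "\<not> q dvd i" using i i0 by (auto dest: dvd_imp_le)
        then have "coprime i q" using q by (metis coprime_commute prime_imp_coprime)
        then have "coprime t q" using t(2) by (metis cong_imp_coprime cong_sym)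
        moreover have "coprime t k" using t(1) by (metis cong_imp_coprime cong_sym coprime_1_left)
        ultimately have "(\<Sum>j<q. coset_rep q k j ^ t * D j) = 0" using t(1) by (intro conj) auto
        moreover have "coset_rep q k j ^ t = coset_rep q k j ^ i" if "j < q" for j
        proof -
          have "coset_rep q k j ^ q = 1" using coset_rep_bij[OF q0 False] that by (auto simp: bij_betw_def)
          then show ?thesis using t(2) unfolding cong_def by (metis root_of_unity_power_mod)
        qed
        ultimately have 1: "(\<Sum>j<q. coset_rep q k j ^ i * D j) = 0" by simp
        \<comment> \<open>The constant \<open>a\<close> contributes nothing to the equation for
          \<open>i\<close>: exchanging \<open>i\<close> and \<open>j\<close> in the exponent turns
          its coefficient into a vanishing geometric sum.\<close>
        have "coset_rep q k j = coset_rep q k 1 ^ j" for j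
          using False by (simp add: coset_rep_def DeMoivre algebra_simps)
        then have 2: "coset_rep q k j ^ i = (coset_rep q k i) ^ j" for j
          by (metis mult.commute power_mult)
        have "coset_rep q k i \<noteq> 1"
          using coset_rep_bij[OF q0 False] i i0 q0 unfolding bij_betw_def inj_on_def
          by (metis coset_rep_0 lessThan_iff)
        moreover have "coset_rep q k i ^ q = 1" using coset_rep_bij[OF q0 False] i by (auto simp: bij_betw_def)
        ultimately have "(\<Sum>j<q. coset_rep q k i ^ j) = 0" by (simp add: geometric_sum)
        then show ?thesis using 1 unfolding right_diff_distrib sum_subtractf
          by (simp add: 2 flip: sum_distrib_right)
      qed
    qed
    then have "\<forall>j<q. D j = a" by simp
    then show ?thesis using False unfolding D_def by blast
  qed
qed

section \<open>Sizes of relations between roots of unity of odd order\<close>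

lemma unity_mset_simps [simp]:
  "unity_mset m {#}" "unity_mset m (add_mset z A) \<longleftrightarrow> z ^ m = 1 \<and> unity_mset m A"
  "unity_mset m (A + B) \<longleftrightarrow> unity_mset m A \<and> unity_mset m B"
  by (auto simp: unity_mset_def)

lemma unity_mset_1: "unity_mset 1 A \<Longrightarrow> \<Sum>\<^sub># A = of_nat (size A)"
  by (induction A) auto

lemma unity_mset_mono: "unity_mset m A \<Longrightarrow> B \<subseteq># A \<Longrightarrow> unity_mset m B"
  unfolding unity_mset_def by (meson mset_subset_eqD)

section \<open>Parity and lower bounds for totals of slice sizes\<close>

lemma even_sum_odd_terms:
  fixes n :: "'a \<Rightarrow> nat"
  assumes "finite S" "\<And>i. i \<in> S \<Longrightarrow> odd (n i)"
  shows "even (sum n S) \<longleftrightarrow> even (card S)"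
  using assms by induction auto

lemma even_sum_same_parity:
  fixes q :: nat and n :: "nat \<Rightarrow> nat"
  assumes "odd q" "\<forall>i<q. \<forall>j<q. even (n i) = even (n j)" "j < q"
  shows "even (\<Sum>i<q. n i) = even (n j)"
proof (cases "even (n j)")
  case True
  then have "even (\<Sum>i<q. n i)" using assms(2,3) by (intro dvd_sum) blast
  then show ?thesis using True by simp
next
  case False
  then have "odd (n i)" if "i < q" for i using assms(2,3) that by blast
  then show ?thesis using even_sum_odd_terms[of "{..<q}" n] assms(1) False by simp
qed

lemma sum_nonzeroE:
  fixes n :: "nat \<Rightarrow> nat"
  assumes "(\<Sum>i<q. n i) \<noteq> 0"
  obtains i where "i < q" "n i \<noteq> 0"
  using assms by auto

text \<open>Estimates a total from a few large slices and at least \<open>l\<close> terms in each of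
  the others. With \<open>card S * l\<close> on the right no subtraction of naturals occurs.\<close>

lemma sum_ge_on_subset:
  fixes n :: "nat \<Rightarrow> nat"
  assumes "S \<subseteq> {..<q}" "\<And>k. k < q \<Longrightarrow> n k \<ge> l"
  shows "sum n S + q * l \<le> (\<Sum>k<q. n k) + card S * l"
proof -
  have S: "finite S" using assms(1) finite_subset by blast
  have "sum n S + sum n ({..<q} - S) = (\<Sum>k<q. n k)"
    using assms(1) by (metis add.commute finite_lessThan sum.subset_diff)
  moreover have "sum n ({..<q} - S) \<ge> of_nat (card ({..<q} - S)) * l"
    by (rule sum_bounded_below) (use assms in auto)
  moreover have "card ({..<q} - S) = q - card S" "card S \<le> q"
    using assms(1) S card_mono[OF finite_lessThan assms(1)] by (simp_all add: card_Diff_subset)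
  ultimately show ?thesis by (simp add: diff_mult_distrib)
qed

lemma sum_ge_single:
  fixes n :: "nat \<Rightarrow> nat"
  assumes "i < q" "\<And>k. k < q \<Longrightarrow> n k \<ge> l"
  shows "n i + q * l \<le> (\<Sum>k<q. n k) + l"
  using sum_ge_on_subset[of "{i}" q l n] assms by simp

lemma sum_ge_pair:
  fixes n :: "nat \<Rightarrow> nat"
  assumes "i < q" "j < q" "i \<noteq> j" "\<And>k. k < q \<Longrightarrow> n k \<ge> l"
  shows "n i + n j + q * l \<le> (\<Sum>k<q. n k) + 2 * l"
  using sum_ge_on_subset[of "{i, j}" q l n] assms by simp

lemma sum_ge_triple:
  fixes n :: "nat \<Rightarrow> nat"
  assumes "i < q" "j < q" "k < q" "i \<noteq> j" "i \<noteq> k" "j \<noteq> k" "\<And>k. k < q \<Longrightarrow> n k \<ge> l"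
  shows "n i + n j + n k + q * l \<le> (\<Sum>k<q. n k) + 3 * l"
  using sum_ge_on_subset[of "{i, j, k}" q l n] assms by simp

lemma odd_power_neg_one_neq:
  fixes u v :: complex
  assumes "odd k" "u ^ k = 1" "v ^ k = 1"
  shows "u \<noteq> - v"
  using assms by (auto simp: power_minus_odd)

text \<open>The two multisets stand for coefficients of both signs. Cut along a prime
  \<open>q\<close>: either all slices have odd size and none is empty, or two slices of different
  parity have the same sum, and their difference is an odd relation of the smaller order
  \<open>k\<close>.\<close>

theorem odd_relation_size:
  assumes "m > 0" "odd m" "\<And>q. prime q \<Longrightarrow> q dvd m \<Longrightarrow> q \<ge> p" "odd p" "p \<ge> 3"
    and "unity_mset m A" "unity_mset m B" "\<Sum>\<^sub># A = \<Sum>\<^sub># B" "odd (size A + size B)"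
  shows "size A + size B \<ge> p \<and> (A \<noteq> {#} \<longrightarrow> B \<noteq> {#} \<longrightarrow> size A + size B \<ge> p + 2)"
  using assms(1-3,6-)
proof (induction m arbitrary: A B rule: less_induct)
  case (less m)
  show ?case
  proof (cases "m = 1")
    case True
    then have "(of_nat (size A) :: complex) = of_nat (size B)"
      using less.prems unity_mset_1 by metis
    then have "size A = size B" by (simp only: of_nat_eq_iff)
    then show ?thesis using less.prems(7) by simp
  next
    case False
    then obtain q where q: "prime q" "q dvd m" using prime_factor_nat by blast
    then obtain k where m: "m = q * k" by blast
    have qp: "q \<ge> p" and qodd: "odd q" using less.prems q by auto
    have k: "k > 0" "odd k" "k < m" using less.prems q m prime_gt_1_nat[of q] by auto
    have kp: "r \<ge> p" if "prime r" "r dvd k" for r using less.prems(3) that m by simp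
    note IH = less.IH[OF k(3) k(1,2) kp]
    define a where "a = (\<lambda>j. slice q k j A)"
    define b where "b = (\<lambda>j. slice q k j B)"
    define n where "n = (\<lambda>j. size (a j) + size (b j))"
    have ua: "unity_mset k (a j)" and ub: "unity_mset k (b j)" for j
      by (simp_all add: a_def b_def unity_mset_slice)
    obtain c where c: "\<And>j. j < q \<Longrightarrow> \<Sum>\<^sub># (a j) - \<Sum>\<^sub># (b j) = c"
      using slices_sum_const[OF q(1) k(1), of A B] less.prems m unfolding a_def b_def by blast
    have sA: "size A = (\<Sum>j<q. size (a j))" and sB: "size B = (\<Sum>j<q. size (b j))"
      using size_eq_slices[OF q(1) k(1)] less.prems m by (simp_all add: a_def b_def)
    then have total: "size A + size B = (\<Sum>j<q. n j)" by (simp add: n_def sum.distrib)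
    show ?thesis
    proof (cases "\<forall>i<q. \<forall>j<q. even (n i) = even (n j)")
      case True
      then have "odd (n j)" if "j < q" for j
        using even_sum_same_parity[OF qodd True that] total less.prems(7) by simp
      then have n1: "n j \<ge> 1" if "j < q" for j using that by (metis even_zero less_one not_le)
      have "(\<Sum>j<q. n j) \<ge> q" using sum_mono[of "{..<q}" "\<lambda>_. 1" n] n1 by simp
      then have ge: "size A + size B \<ge> q" using total by simp
      moreover have "size A + size B \<ge> p + 2" if "A \<noteq> {#}" "B \<noteq> {#}"
      proof (rule ccontr)
        assume "\<not> ?thesis"
        then have "size A + size B = p" using ge qp \<open>odd p\<close> less.prems(7) by presburger
        then have eq: "(\<Sum>j<q. n j) = q" using total ge qp by linarith
        \<comment> \<open>With exactly \<open>p\<close> terms every slice is a single term;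
          comparing a positive term \<open>u\<close> with a negative term \<open>v\<close> would
          give u = - v, impossible in odd order.\<close>
        have none: "n j = 1" if "j < q" for j
          using sum_ge_single[of j q 1 n] n1 eq that by force
        have "size A \<noteq> 0" "size B \<noteq> 0" using that by simp_all
        then have nz: "(\<Sum>j<q. size (a j)) \<noteq> 0" "(\<Sum>j<q. size (b j)) \<noteq> 0" unfolding sA sB .
        obtain i where i: "i < q" "size (a i) \<noteq> 0" using nz(1) by (rule sum_nonzeroE)
        obtain j where j: "j < q" "size (b j) \<noteq> 0" using nz(2) by (rule sum_nonzeroE)
        have "size (a i) = 1" "size (b i) = 0" "size (b j) = 1" "size (a j) = 0"
          using none[OF i(1)] none[OF j(1)] i(2) j(2) unfolding n_def by linarith+
        then obtain u v where uv: "a i = {#u#}" "b i = {#}" "b j = {#v#}" "a j = {#}"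
          by (metis size_1_singleton_mset size_eq_0_iff_empty)
        then have "u = - v" using c[OF i(1)] c[OF j(1)] by simp
        moreover have "u ^ k = 1" "v ^ k = 1" using ua[of i] ub[of j] uv by simp_all
        ultimately show False using odd_power_neg_one_neq[OF k(2)] by blast
      qed
      ultimately show ?thesis using qp by simp
    next
      case False
      then obtain i j where ij: "i < q" "j < q" "even (n i) \<noteq> even (n j)" by blast
      then have "i \<noteq> j" by auto
      \<comment> \<open>The unknown \<open>c\<close> is eliminated by subtracting the two slice
        equations; the \<open>b\<close> parts change sides to keep all coefficients
        positive.\<close>
      have "\<Sum>\<^sub># (a j + b i) = \<Sum>\<^sub># (a i + b j)" using c[OF ij(1)] c[OF ij(2)]
        by (simp add: algebra_simps)
      moreover have "odd (size (a j + b i) + size (a i + b j))" using ij by (auto simp: n_def)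
      ultimately have IH': "size (a j + b i) + size (a i + b j) \<ge> p"
        "a j + b i \<noteq> {#} \<Longrightarrow> a i + b j \<noteq> {#} \<Longrightarrow> size (a j + b i) + size (a i + b j) \<ge> p + 2"
        using IH[of "a j + b i" "a i + b j"] ua ub by auto
      have tot: "(\<Sum>k<q. n k) \<ge> n i + n j" using sum_ge_pair[of i q j 0 n] ij \<open>i \<noteq> j\<close> by simp
      have nij: "size (a j + b i) + size (a i + b j) = n i + n j" by (simp add: n_def)
      have "size A + size B \<ge> p + 2" if ne: "A \<noteq> {#}" "B \<noteq> {#}"
      proof (rule ccontr)
        assume "\<not> ?thesis"
        then have small: "size A + size B < p + 2" by simp
        \<comment> \<open>If there are only \<open>p\<close> terms and one crossed side is empty,
          then \<open>A\<close> lives in slice \<open>i\<close> and \<open>B\<close> in slice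
          \<open>j\<close>. A third slice is empty, so \<open>c = 0\<close>. Now two vanishing sums
          share \<open>p\<close> terms; the one of odd size takes them all, and the other is
          empty.\<close>
        have key: False if ij: "i < q" "j < q" "i \<noteq> j" and e: "a j + b i = {#}"
          and s: "n i + n j = p" "(\<Sum>k<q. n k) = p" for i j
        proof -
          have e': "a j = {#}" "b i = {#}" using e by auto
          have rest: "n l = 0" if "l < q" "l \<noteq> i" "l \<noteq> j" for l
          proof -
            have "n i + (n j + (n l + sum n ({..<q} - {i} - {j} - {l}))) = (\<Sum>k<q. n k)"
              using ij that
              by (subst sum.remove[of _ i], simp, simp, subst sum.remove[of _ j], simp, simp, subst sum.remove[of _ l]) auto
            then show ?thesis using s by simp
          qed
          have sAi: "size (a l) = 0" if "l < q" "l \<noteq> i" for l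
            using rest[OF that] e'(1) by (cases "l = j") (auto simp: n_def)
          have sBj: "size (b l) = 0" if "l < q" "l \<noteq> j" for l
            using rest[OF that(1)] that(2) e'(2) by (cases "l = i") (auto simp: n_def)
          have "size A = (\<Sum>l<q. if l = i then size (a i) else 0)"
            unfolding sA by (intro sum.cong) (use sAi in auto)
          then have a_ne: "a i \<noteq> {#}" using ne(1) ij by auto
          have "size B = (\<Sum>l<q. if l = j then size (b j) else 0)"
            unfolding sB by (intro sum.cong) (use sBj in auto)
          then have b_ne: "b j \<noteq> {#}" using ne(2) ij by auto
          have "card {i, j} < card {..<q}" using ij qp \<open>p \<ge> 3\<close> by simp
          then obtain l where "l < q" "l \<noteq> i" "l \<noteq> j"
            by (metis card_mono finite_lessThan finite.intros insertCI insert_iff lessThan_iff not_le subsetI)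
          then have "c = 0" using c[of l] sAi[of l] sBj[of l] by simp
          then have z: "\<Sum>\<^sub># (a i) = \<Sum>\<^sub># {#}" "\<Sum>\<^sub># (b j) = \<Sum>\<^sub># {#}"
            using c[OF ij(1)] c[OF ij(2)] e' by simp_all
          have sz: "size (a i) + size (b j) = p" using s e' by (simp add: n_def)
          have "size (a i) \<ge> p" if "odd (size (a i))" using IH[of "a i" "{#}"] ua z that by simp
          moreover have "size (b j) \<ge> p" if "odd (size (b j))" using IH[of "b j" "{#}"] ub z that by simp
          ultimately show False using sz \<open>odd p\<close> a_ne b_ne
            by (metis add_diff_cancel_left' add_diff_cancel_right' diff_is_0_eq even_add size_eq_0_iff_empty)
        qed
        have "size A + size B \<noteq> p + 1" by (metis even_plus_one_iff less.prems(7) \<open>odd p\<close>)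
        then have "(\<Sum>k<q. n k) = p" and s: "n i + n j = p"
          using small IH'(1) tot nij total by linarith+
        moreover have "a j + b i = {#} \<or> a i + b j = {#}" using IH'(2) nij s by auto
        ultimately show False using key[of i j] key[of j i] ij \<open>i \<noteq> j\<close> by (auto simp: add.commute)
      qed
      then show ?thesis using IH'(1) tot nij total by simp
    qed
  qed
qed

text \<open>Where slice sums agree, the congruence is inherited from the slices. They can differ
  only at the last factor \<open>p\<close>: there the slices consist of ones, so the sizes differ by
  the same integer in each of the \<open>p\<close> slices.\<close>

lemma vanishing_prime_power_size:
  assumes "prime p" "unity_mset (p ^ e) A" "unity_mset (p ^ e) B" "\<Sum>\<^sub># A = \<Sum>\<^sub># B"
  shows "[size A = size B] (mod p)"
  using assms(2-)
proof (induction e arbitrary: A B)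
  case 0
  then have "(of_nat (size A) :: complex) = of_nat (size B)" using unity_mset_1 by simp
  then show ?case by (simp only: of_nat_eq_iff cong_refl)
next
  case (Suc e)
  have p: "p ^ e > 0" using assms(1) prime_gt_0_nat by simp
  have u: "unity_mset (p * p ^ e) A" "unity_mset (p * p ^ e) B" using Suc.prems by auto
  obtain c where c: "\<And>j. j < p \<Longrightarrow> \<Sum>\<^sub># (slice p (p ^ e) j A) - \<Sum>\<^sub># (slice p (p ^ e) j B) = c"
    and c0: "c = 0 \<or> \<not> p dvd p ^ e"
    using slices_sum_const[OF assms(1) p u Suc.prems(3)] by blast
  have sz: "size A = (\<Sum>j<p. size (slice p (p ^ e) j A))" "size B = (\<Sum>j<p. size (slice p (p ^ e) j B))"
    using size_eq_slices[OF assms(1) p] u by blast+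
  show ?case
  proof (cases "c = 0")
    case True
    have "[size (slice p (p ^ e) j A) = size (slice p (p ^ e) j B)] (mod p)" if "j < p" for j
      using c[OF that] True by (intro Suc.IH unity_mset_slice) simp
    then show ?thesis unfolding sz by (intro cong_sum) auto
  next
    case False
    then have "e = 0" using c0 by (cases e) auto
    then have "\<Sum>\<^sub># (slice p (p ^ e) j C) = of_nat (size (slice p (p ^ e) j C))" for j C
      using unity_mset_1 unity_mset_slice by (metis power_0)
    then have d: "of_nat (size (slice p (p ^ e) j A)) - of_nat (size (slice p (p ^ e) j B)) = c" if "j < p" for j
      using c[OF that] by simp
    have "(of_nat (size A) :: complex) - of_nat (size B) = of_nat p * c"
      unfolding sz of_nat_sum sum_subtractf[symmetric] using d by simp
    moreover have "c = of_int (int (size (slice p (p ^ e) 0 A)) - int (size (slice p (p ^ e) 0 B)))"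
      using d[of 0] assms(1) prime_gt_0_nat by auto
    ultimately have "(of_int (int (size A) - int (size B)) :: complex) =
      of_int (int p * (int (size (slice p (p ^ e) 0 A)) - int (size (slice p (p ^ e) 0 B))))"
      by simp
    then have "int (size A) - int (size B) = int p * (int (size (slice p (p ^ e) 0 A)) - int (size (slice p (p ^ e) 0 B)))"
      by (simp only: of_int_eq_iff)
    then have "[int (size A) = int (size B)] (mod int p)" by (simp add: cong_iff_dvd_diff)
    then show ?thesis by (simp add: cong_int_iff)
  qed
qed

text \<open>For even size, vanishing slices include a nonempty even one, treated by induction, or
  two odd ones with \<open>p\<close> terms each. Nonvanishing slices are never empty, and counting
  gives at least \<open>2 * q\<close> or \<open>p + q\<close> terms.\<close>

theorem vanishing_size:
  assumes "m > 0" "odd m" "\<And>q. prime q \<Longrightarrow> q dvd m \<Longrightarrow> q \<ge> p" "odd p" "p \<ge> 3"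
    and "unity_mset m A" "\<Sum>\<^sub># A = 0" "A \<noteq> {#}"
  shows "size A \<ge> (if even (size A) then 2 * p else p)"
proof (cases "odd (size A)")
  case True
  then show ?thesis using odd_relation_size[OF assms(1-5) assms(6), of "{#}"] assms(7) by simp
next
  case False
  then have "even (size A)" by simp
  then have "size A \<ge> 2 * p" using assms(1-3,6-)
  proof (induction m arbitrary: A rule: less_induct)
    case (less m)
    have "m \<noteq> 1" using unity_mset_1[of A] less.prems by auto
    then obtain q where q: "prime q" "q dvd m" using prime_factor_nat by blast
    then obtain k where m: "m = q * k" by blast
    have qp: "q \<ge> p" and qodd: "odd q" using less.prems q by auto
    have k: "k > 0" "odd k" "k < m" using less.prems q m prime_gt_1_nat[of q] by auto
    have kp: "r \<ge> p" if "prime r" "r dvd k" for r using less.prems(4) that m by simp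
    define a where "a = (\<lambda>j. slice q k j A)"
    define n where "n = (\<lambda>j. size (a j))"
    have ua: "unity_mset k (a j)" for j by (simp add: a_def unity_mset_slice)
    obtain c where c: "\<And>j. j < q \<Longrightarrow> \<Sum>\<^sub># (a j) = c"
      using slices_sum_const[OF q(1) k(1), of A "{#}"] less.prems m unfolding a_def by auto
    have sA: "size A = (\<Sum>j<q. n j)"
      using size_eq_slices[OF q(1) k(1)] less.prems m by (simp add: a_def n_def)
    have T: "n i + n j \<ge> p + 2" if "i < q" "j < q" "n i \<noteq> 0" "n j \<noteq> 0" "odd (n i + n j)" for i j
      using odd_relation_size[OF k(1,2) kp assms(4,5), of "a i" "a j"] ua c that by (auto simp: n_def)
    show ?case
    proof (cases "c = 0")
      case True
      have "size A \<noteq> 0" using less.prems(7) by simp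
      then obtain i where i: "i < q" "n i \<noteq> 0" unfolding sA by (rule sum_nonzeroE)
      have le: "n i \<le> size A" using sum_ge_single[OF i(1), of 0 n] sA by simp
      have odd_ge: "n j \<ge> p" if "j < q" "odd (n j)" for j
        using odd_relation_size[OF k(1,2) kp assms(4,5), of "a j" "{#}"] ua that c True by (simp add: n_def)
      show ?thesis
      proof (cases "even (n i)")
        case True
        then have "n i \<ge> 2 * p" unfolding n_def
          by (intro less.IH[OF k(3)] k kp ua) (use i c \<open>c = 0\<close> in \<open>auto simp: n_def\<close>)
        then show ?thesis using le by simp
      next
        case False
        have "\<exists>j<q. j \<noteq> i \<and> odd (n j)"
        proof (rule ccontr)
          assume "\<not> ?thesis"
          then have "even (sum n ({..<q} - {i}))" by (intro dvd_sum) auto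
          moreover have "size A = n i + sum n ({..<q} - {i})"
            using i sA by (simp add: sum.remove[of _ i])
          ultimately show False using False less.prems(1) by simp
        qed
        then obtain j where j: "j < q" "j \<noteq> i" "odd (n j)" by blast
        then show ?thesis using sum_ge_pair[of i q j 0 n] i odd_ge[of i] odd_ge[of j] False sA by simp
      qed
    next
      case False
      then have n1: "n j \<ge> 1" if "j < q" for j
        using c[OF that] by (cases "a j = {#}") (auto simp: n_def Suc_le_eq nonempty_has_size)
      show ?thesis
      proof (cases "\<forall>i<q. \<forall>j<q. even (n i) = even (n j)")
        case True
        have "even (n j)" if "j < q" for j
          using even_sum_same_parity[OF qodd True that] sA less.prems(1) by simp
        then have "n j \<ge> 2" if "j < q" for j
          using n1[OF that] that by (metis One_nat_def Suc_leI le_neq_implies_less odd_one one_add_one plus_1_eq_Suc)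
        then have "(\<Sum>j<q. n j) \<ge> q * 2" using sum_mono[of "{..<q}" "\<lambda>_. 2" n] by simp
        then show ?thesis using sA qp by simp
      next
        case False
        then obtain i j where ij: "i < q" "j < q" "even (n i) \<noteq> even (n j)" by blast
        then have "i \<noteq> j" by auto
        have "odd (n i + n j)" using ij by auto
        then have "n i + n j \<ge> p + 2" using T[OF ij(1,2)] n1[OF ij(1)] n1[OF ij(2)] by simp
        then show ?thesis using sum_ge_pair[OF ij(1,2) \<open>i \<noteq> j\<close>, of 1 n] n1 sA qp by simp
      qed
    qed
  qed
  then show ?thesis using False by simp
qed

section \<open>Rotated regular polygons\<close>

definition gon :: "complex \<Rightarrow> nat \<Rightarrow> complex multiset" where
  "gon g q = mset_set {z. (z / g) ^ q = 1}"

lemma coset_roots_eq: "g \<noteq> 0 \<Longrightarrow> {z::complex. (z / g) ^ q = 1} = (*) g ` {z. z ^ q = 1}"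
proof -
  assume g: "g \<noteq> 0"
  have "z \<in> (*) g ` {z. z ^ q = 1}" if "(z / g) ^ q = 1" for z
    using that g by (intro image_eqI[of _ _ "z / g"]) auto
  then show ?thesis using g by auto
qed

lemma finite_coset_roots:
  assumes "g \<noteq> 0" "q > 0"
  shows "finite {z::complex. (z / g) ^ q = 1}"
  unfolding coset_roots_eq[OF assms(1)] using assms(2) by (intro finite_imageI finite_roots_unity) simp

lemma mem_gon_iff [simp]: "g \<noteq> 0 \<Longrightarrow> q > 0 \<Longrightarrow> z \<in># gon g q \<longleftrightarrow> (z / g) ^ q = 1"
  by (simp add: gon_def finite_coset_roots)

lemma gon_eq_image:
  assumes "g \<noteq> 0"
  shows "gon g q = image_mset ((*) g) (mset_set {z. z ^ q = 1})"
  using assms by (simp add: gon_def coset_roots_eq image_mset_mset_set inj_on_def)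

lemma size_gon [simp]: "g \<noteq> 0 \<Longrightarrow> q > 0 \<Longrightarrow> size (gon g q) = q"
  by (simp add: gon_eq_image card_roots_unity_eq)

lemma sum_gon [simp]:
  assumes "g \<noteq> 0" "q > 1"
  shows "\<Sum>\<^sub># (gon g q) = 0"
proof -
  have "\<Sum>\<^sub># (gon g q) = g * \<Sum>\<^sub># (mset_set {z. z ^ q = 1})"
    using sum_mset_distrib_left[of g "\<lambda>x. x" "mset_set {z. z ^ q = 1}"] assms(1) by (simp add: gon_eq_image)
  also have "\<Sum>\<^sub># (mset_set {z::complex. z ^ q = 1}) = 0"
    using sum_roots_unity[OF assms(2)] sum_unfold_sum_mset[of "\<lambda>x::complex. x"] by simp
  finally show ?thesis by simp
qed

lemma image_gon:
  assumes "g \<noteq> 0" "r \<noteq> 0"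
  shows "image_mset ((*) r) (gon g q) = gon (r * g) q"
  using assms by (simp add: gon_eq_image image_mset.compositionality o_def mult.assoc[abs_def])

lemma gon_cong:
  assumes "g \<noteq> 0" "(h / g) ^ q = 1" "q > 0"
  shows "gon h q = gon g q"
proof -
  have "h \<noteq> 0" using assms by (auto simp: power_0_left)
  then have "(z / h) ^ q = (z / g) ^ q" for z using assms by (simp add: power_divide)
  then show ?thesis by (simp add: gon_def)
qed

lemma unity_mset_gon:
  assumes "g ^ m = 1" "q dvd m" "m > 0"
  shows "unity_mset m (gon g q)"
proof -
  have g: "g \<noteq> 0" using assms by (auto simp: power_0_left)
  obtain k where m: "m = q * k" using assms(2) by blast
  have "z ^ m = 1" if "z \<in># gon g q" for z
  proof -
    have "(z / g) ^ q = 1" using that g assms m by simp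
    then have "(z / g) ^ m = 1" by (simp add: m power_mult)
    then show ?thesis using assms(1) by (simp add: power_divide)
  qed
  then show ?thesis by (simp add: unity_mset_def)
qed

text \<open>Cosets of groups of coprime order meet in at most one point. So counting terms in a
  coset of the \<open>p\<close>-th roots of unity tells the \<open>p\<close>-gons of a union from
  its other polygons.\<close>

lemma filter_gon_distinct_primes:
  assumes "prime p" "prime q" "p \<noteq> q" "a \<noteq> 0" "g \<noteq> 0"
  shows "size (filter_mset (\<lambda>z. (z / a) ^ p = 1) (gon g q)) \<le> 1"
proof -
  have q: "q > 0" using assms(2) by (rule prime_gt_0_nat)
  have p: "p > 0" using assms(1) by (rule prime_gt_0_nat)
  let ?S = "{z. (z / g) ^ q = 1 \<and> (z / a) ^ p = 1}"
  have fin: "finite ?S" by (rule finite_subset[OF _ finite_coset_roots[OF assms(5) q]]) auto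
  have "z = z'" if "z \<in> ?S" "z' \<in> ?S" for z z'
  proof -
    have z0: "z' \<noteq> 0" using that q by (auto simp: power_0_left)
    have "(z / z') ^ q = (z / g) ^ q / (z' / g) ^ q" "(z / z') ^ p = (z / a) ^ p / (z' / a) ^ p"
      using assms z0 by (simp_all add: power_divide)
    then have "(z / z') ^ q = 1" "(z / z') ^ p = 1" using that by simp_all
    moreover have "coprime q p" using assms(1-3) by (simp add: primes_coprime)
    ultimately have "z / z' = 1" using root_of_unity_coprime by blast
    then show ?thesis using z0 by simp
  qed
  then have "card ?S \<le> 1" unfolding One_nat_def card_le_Suc0_iff_eq[OF fin] by blast
  then show ?thesis unfolding gon_def using finite_coset_roots[OF assms(5) q] by simp
qed

lemma filter_gon_eq:
  assumes "p > 0" "a \<noteq> 0" "g \<noteq> 0" "filter_mset (\<lambda>z. (z / a) ^ p = 1) (gon g p) \<noteq> {#}"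
  shows "gon g p = gon a p"
proof -
  obtain z where z: "(z / g) ^ p = 1" "(z / a) ^ p = 1"
    using assms by (auto simp: filter_mset_eq_mempty_iff)
  then have "z \<noteq> 0" using assms(1) by (auto simp: power_0_left)
  have "gon z p = gon g p" "gon z p = gon a p" using gon_cong z assms by blast+
  then show ?thesis by simp
qed

lemma filter_gon_self: "p > 0 \<Longrightarrow> a \<noteq> 0 \<Longrightarrow> filter_mset (\<lambda>z. (z / a) ^ p = 1) (gon a p) = gon a p"
  by (simp add: gon_def finite_coset_roots)

text \<open>The sum is \<open>- a\<close>: adding \<open>gon_rest a p\<close> cancels a term \<open>a\<close>, although \<open>- a\<close> is no
  root of unity of odd order.\<close>

definition gon_rest :: "complex \<Rightarrow> nat \<Rightarrow> complex multiset" where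
  "gon_rest a p = gon a p - {#a#}"

lemma gon_eq_add_rest:
  assumes "a \<noteq> 0" "p > 0"
  shows "gon a p = add_mset a (gon_rest a p)"
  using assms by (simp add: gon_rest_def)

lemma gon_rest:
  assumes "a \<noteq> 0" "p > 1"
  shows "size (gon_rest a p) = p - 1" "\<Sum>\<^sub># (gon_rest a p) = - a"
    "filter_mset (\<lambda>z. (z / a) ^ p = 1) (gon_rest a p) = gon_rest a p"
proof -
  have eq: "gon a p = add_mset a (gon_rest a p)" using assms by (simp add: gon_eq_add_rest)
  show "size (gon_rest a p) = p - 1" using arg_cong[OF eq, of size] assms by simp
  show "\<Sum>\<^sub># (gon_rest a p) = - a"
    using arg_cong[OF eq, of "\<Sum>\<^sub>#"] assms by (simp add: add_eq_0_iff)
  have "filter_mset (\<lambda>z. (z / a) ^ p = 1) (add_mset a (gon_rest a p)) = add_mset a (gon_rest a p)"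
    using filter_gon_self[of p a] assms eq by simp
  then show "filter_mset (\<lambda>z. (z / a) ^ p = 1) (gon_rest a p) = gon_rest a p" using assms by simp
qed

lemma unity_mset_gon_rest: "a ^ m = 1 \<Longrightarrow> p dvd m \<Longrightarrow> m > 0 \<Longrightarrow> unity_mset m (gon_rest a p)"
  unfolding gon_rest_def by (rule unity_mset_mono[OF unity_mset_gon]) auto

definition is_gon :: "nat \<Rightarrow> complex multiset \<Rightarrow> bool" where
  "is_gon m A \<longleftrightarrow> (\<exists>g q. prime q \<and> q dvd m \<and> g \<noteq> 0 \<and> A = gon g q)"

definition is_two_gons :: "nat \<Rightarrow> complex multiset \<Rightarrow> bool" where
  "is_two_gons m A \<longleftrightarrow> (\<exists>B C. is_gon m B \<and> is_gon m C \<and> A = B + C)"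

lemma is_gon_image:
  assumes "is_gon k A" "r \<noteq> 0"
  shows "is_gon (q * k) (image_mset ((*) r) A)"
  using assms image_gon unfolding is_gon_def by (metis dvd_mult mult_eq_0_iff)

lemma is_two_gons_image:
  assumes "is_two_gons k A" "r \<noteq> 0"
  shows "is_two_gons (q * k) (image_mset ((*) r) A)"
  using assms is_gon_image unfolding is_two_gons_def by (metis image_mset_union)

text \<open>On the unit circle conjugation is inversion, so the conjugated equation compares (a + b)
  / (a b) with (c + d) / (c d). A nonzero sum thus determines the product, and both determine the
  pair.\<close>

lemma sum_of_two_unit_complex:
  fixes a b c d :: complex
  assumes "norm a = 1" "norm b = 1" "norm c = 1" "norm d = 1" "a + b = c + d" "a + b \<noteq> 0"
  shows "{#a, b#} = {#c, d#}"
proof -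
  have inv: "cnj z = 1 / z" "z \<noteq> 0" if "norm z = 1" for z
    using that by (auto simp: divide_conv_cnj)
  have "cnj a + cnj b = cnj c + cnj d" using assms(5) by (metis complex_cnj_add)
  then have "1 / a + 1 / b = 1 / c + 1 / d" using inv assms by simp
  then have "(a + b) / (a * b) = (c + d) / (c * d)"
    using inv(2) assms(1-4) by (simp add: add_divide_distrib add.commute)
  then have "a * b = c * d" using assms(5,6) inv(2) assms(1-4) by (simp add: frac_eq_eq)
  moreover have "(c - a) * (c - b) = c * c - c * (a + b) + a * b" by (simp add: algebra_simps)
  ultimately have "(c - a) * (c - b) = 0" using assms(5) by (simp add: algebra_simps)
  then have "c = a \<or> c = b" by auto
  then show ?thesis using assms(5) by auto
qed

section \<open>Sums whose value is one root of unity or a sum of two\<close>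

locale two_smallest_primes =
  fixes p p2 :: nat
  assumes prime_p: "prime p" and odd_p: "odd p" and p2: "p + 2 \<le> p2"
begin

text \<open>Here \<open>p2\<close> is a lower bound for the other primes rather than one of them, so
  the condition passes from \<open>q * k\<close> to \<open>k\<close> as long as \<open>p\<close>
  divides \<open>k\<close>.\<close>

definition admissible :: "nat \<Rightarrow> bool" where
  "admissible m \<longleftrightarrow> m > 0 \<and> odd m \<and> p dvd m \<and> (\<forall>q. prime q \<longrightarrow> q dvd m \<longrightarrow> q = p \<or> p2 \<le> q)"

text \<open>The alternatives with \<open>p dvd size A\<close> cannot occur for a power of two; they make the two
  classifications strong enough to be proved for all sizes by a simultaneous induction.\<close>

definition odd_classified :: "nat \<Rightarrow> bool" where
  "odd_classified m \<longleftrightarrow> (\<forall>A. unity_mset m A \<longrightarrow> \<Sum>\<^sub># A = 0 \<longrightarrow> odd (size A) \<longrightarrow> size A < 2 * p + p2 \<longrightarrow>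
     is_gon m A \<or> p dvd size A \<and> 3 * p \<le> size A)"

definition even_classified :: "nat \<Rightarrow> bool" where
  "even_classified m \<longleftrightarrow> (\<forall>A. unity_mset m A \<longrightarrow> \<Sum>\<^sub># A = 0 \<longrightarrow> even (size A) \<longrightarrow> A \<noteq> {#} \<longrightarrow>
     size A < 3 * p + p2 \<longrightarrow> is_two_gons m A \<or> p dvd size A \<and> 4 * p \<le> size A)"

lemma p_ge_3: "p \<ge> 3"
  using prime_ge_2_nat[OF prime_p] odd_p by (cases "p = 2") auto

lemma admissibleD:
  assumes "admissible m"
  shows "m > 0" "odd m" "p dvd m" "\<And>q. prime q \<Longrightarrow> q dvd m \<Longrightarrow> p \<le> q"
    "\<And>q. prime q \<Longrightarrow> q dvd m \<Longrightarrow> q \<noteq> p \<Longrightarrow> p2 \<le> q" "\<And>q. q dvd m \<Longrightarrow> odd q"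
proof -
  show "m > 0" "odd m" "p dvd m" using assms by (simp_all add: admissible_def)
  have *: "q = p \<or> p2 \<le> q" if "prime q" "q dvd m" for q
    using assms that unfolding admissible_def by blast
  show "p \<le> q" if "prime q" "q dvd m" for q using *[OF that] p2 by auto
  show "p2 \<le> q" if "prime q" "q dvd m" "q \<noteq> p" for q using *[OF that(1,2)] that(3) by blast
  show "\<And>q. q dvd m \<Longrightarrow> odd q" using \<open>odd m\<close> dvd_trans by blast
qed

lemma size_is_gon:
  assumes "is_gon m A"
  shows "\<exists>q. prime q \<and> q dvd m \<and> size A = q"
  using assms by (auto simp: is_gon_def prime_gt_0_nat)

text \<open>The rest has at least two terms in one coset of the \<open>p\<close>-th roots of unity,
  and a polygon of another prime meets this coset at most once.\<close>

lemma gon_containing_rest: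
  assumes "B + gon_rest a p = gon g q" "prime q" "a \<noteq> 0" "g \<noteq> 0"
  shows "q = p"
proof (rule ccontr)
  assume ne: "q \<noteq> p"
  let ?F = "filter_mset (\<lambda>z. (z / a) ^ p = 1)"
  have "p - 1 \<le> size (?F (B + gon_rest a p))"
    using gon_rest(1,3)[of a p] assms(3) p_ge_3 by simp
  moreover have "size (?F (gon g q)) \<le> 1"
    using ne by (intro filter_gon_distinct_primes prime_p assms) auto
  ultimately show False using assms(1) p_ge_3 by simp
qed

text \<open>Adding \<open>gon_rest a p\<close> to a shorter \<open>A\<close> gives a vanishing sum
  of odd size below \<open>3 * p\<close>, that is a single polygon, and in fact a
  \<open>p\<close>-gon; this leaves one term for \<open>A\<close>.\<close>

lemma sum_one_root_odd:
  assumes m: "admissible m" and O: "odd_classified m"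
    and A: "unity_mset m A" "odd (size A)" "\<Sum>\<^sub># A = a" and a: "a ^ m = 1"
  shows "A = {#a#} \<or> size A \<ge> 2 * p + 1"
proof (rule ccontr)
  assume neg: "\<not> ?thesis"
  note adm = admissibleD[OF m]
  have a0: "a \<noteq> 0" using a adm(1) by (auto simp: power_0_left)
  define B where "B = A + gon_rest a p"
  have sz: "size B = size A + (p - 1)" using a0 p_ge_3 by (simp add: B_def gon_rest)
  have "unity_mset m B" using A a adm by (simp add: B_def unity_mset_gon_rest)
  moreover have "\<Sum>\<^sub># B = 0" using A a0 p_ge_3 by (simp add: B_def gon_rest)
  moreover have "odd (size B)" using sz A(2) odd_p by simp
  moreover have "size B < 3 * p" using sz neg p_ge_3 by linarith
  ultimately have "is_gon m B" using O p2 unfolding odd_classified_def by fastforce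
  then obtain g q where gq: "prime q" "q dvd m" "g \<noteq> 0" "B = gon g q" unfolding is_gon_def by blast
  have "q = p" using gon_containing_rest[of A a g q] gq a0 by (simp add: B_def)
  then have "size B = p" using gq p_ge_3 by simp
  then have "size A = 1" using sz p_ge_3 by linarith
  then obtain u where "A = {#u#}" by (metis size_1_singleton_mset)
  then show False using neg A(3) by simp
qed

text \<open>The rests of two \<open>p\<close>-gons are added; the single \<open>p\<close>-gon that
  should result has no room for their \<open>2 * (p - 1)\<close> terms.\<close>

lemma sum_two_roots_odd:
  assumes m: "admissible m" and O: "odd_classified m"
    and A: "unity_mset m A" "odd (size A)" "\<Sum>\<^sub># A = a + b" and ab: "a ^ m = 1" "b ^ m = 1"
  shows "size A \<ge> p + 2"
proof (rule ccontr)
  assume neg: "\<not> ?thesis"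
  note adm = admissibleD[OF m]
  have ab0: "a \<noteq> 0" "b \<noteq> 0" using ab adm(1) by (auto simp: power_0_left)
  define B where "B = A + gon_rest b p + gon_rest a p"
  have sz: "size B = size A + (p - 1) + (p - 1)" using ab0 p_ge_3 by (simp add: B_def gon_rest)
  have "unity_mset m B" using A ab adm by (simp add: B_def unity_mset_gon_rest)
  moreover have "\<Sum>\<^sub># B = 0" using A ab0 p_ge_3 by (simp add: B_def gon_rest)
  moreover have "odd (size B)" using sz A(2) odd_p by simp
  moreover have "size B < 3 * p" using sz neg p_ge_3 by linarith
  ultimately have "is_gon m B" using O p2 unfolding odd_classified_def by fastforce
  then obtain g q where gq: "prime q" "q dvd m" "g \<noteq> 0" "B = gon g q" unfolding is_gon_def by blast
  have "q = p" using gon_containing_rest[of "A + gon_rest b p" a g q] gq ab0 by (simp add: B_def)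
  then have "size B = p" using gq p_ge_3 by simp
  then show False using sz p_ge_3 by linarith
qed

text \<open>Made for one of \<open>q\<close> nonempty slices with sum \<open>a\<close>: in the
  second alternative this slice and one term in each of the other \<open>q - 1\<close> already reach
  \<open>3 * p + p2\<close>. The first one arises when one of the two polygons of \<open>B\<close>
  is the \<open>p\<close>-gon through \<open>a\<close>.\<close>

lemma sum_one_root_even:
  assumes m: "admissible m" and E: "even_classified m"
    and A: "unity_mset m A" "even (size A)" "\<Sum>\<^sub># A = a" and a: "a ^ m = 1"
    and q: "prime q" "odd q" "p2 \<le> q" "\<not> q dvd m" and small: "size A + p \<le> 4 * p"
  shows "(\<exists>C. is_gon m C \<and> A = add_mset a C) \<or> size A + q \<ge> 3 * p + p2 + 1"
proof -
  note adm = admissibleD[OF m]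
  have a0: "a \<noteq> 0" using a adm(1) by (auto simp: power_0_left)
  define B where "B = A + gon_rest a p"
  have sz: "size B = size A + (p - 1)" using a0 p_ge_3 by (simp add: B_def gon_rest)
  have "B \<noteq> {#}" using sz p_ge_3 by (auto simp: size_eq_0_iff_empty[symmetric] simp del: size_eq_0_iff_empty)
  moreover have "unity_mset m B" using A a adm by (simp add: B_def unity_mset_gon_rest)
  moreover have "\<Sum>\<^sub># B = 0" using A a0 p_ge_3 by (simp add: B_def gon_rest)
  moreover have "even (size B)" using sz A(2) odd_p by simp
  moreover have lt: "size B < 4 * p" using sz small p_ge_3 by linarith
  ultimately have "is_two_gons m B" using E p2 unfolding even_classified_def by fastforce
  then obtain g h q1 q2 where gq: "prime q1" "q1 dvd m" "g \<noteq> 0" "prime q2" "q2 dvd m" "h \<noteq> 0"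
    "B = gon g q1 + gon h q2" unfolding is_two_gons_def is_gon_def by blast
  have gon_a: ?thesis if "gon a p + C = B" "is_gon m C" for C
  proof -
    have "add_mset a C = A" using that(1) gon_eq_add_rest[of a p] a0 p_ge_3 by (auto simp: B_def)
    then show ?thesis using that(2) by auto
  qed
  let ?F = "filter_mset (\<lambda>z. (z / a) ^ p = 1)"
  show ?thesis
  proof (cases "gon g q1 = gon a p \<or> gon h q2 = gon a p")
    case True
    have "is_gon m (gon g q1)" "is_gon m (gon h q2)" using gq unfolding is_gon_def by blast+
    then show ?thesis using gon_a[of "gon h q2"] gon_a[of "gon g q1"] gq(7) True
      by (auto simp: add.commute)
  next
    case False
    have F0: "size (?F (gon g' q')) \<le> (if q' = p then 0 else 1)"
      if "gon g' q' \<noteq> gon a p" "prime q'" "g' \<noteq> 0" for g' q'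
      using filter_gon_distinct_primes[OF prime_p that(2) _ a0 that(3)] filter_gon_eq[of p a g'] that a0 p_ge_3
      by auto
    have "p - 1 \<le> size (?F B)" using gon_rest(1,3)[of a p] a0 p_ge_3 by (simp add: B_def)
    also have "\<dots> = size (?F (gon g q1)) + size (?F (gon h q2))" using gq by simp
    also have "\<dots> \<le> (if q1 = p then 0 else 1) + (if q2 = p then 0 else 1)"
      using F0 False gq by (intro add_mono) auto
    \<comment> \<open>Neither polygon is the \<open>p\<close>-gon through \<open>a\<close>, so at
      most two of the \<open>p - 1\<close> added terms find a place. Only \<open>p = 3\<close> is
      left, where sizes are compared.\<close>
    finally have "p = 3" "q1 \<noteq> p" "q2 \<noteq> p" using p_ge_3 by (auto split: if_splits)
    moreover have "odd q1" "odd q2" "q1 \<noteq> q" "q2 \<noteq> q" using adm(6) gq q by auto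
    moreover have "p2 \<le> q1" "p2 \<le> q2" using adm(5) gq calculation by auto
    moreover have "size A + 2 = q1 + q2"
    proof -
      have "size B = q1 + q2" using gq by (simp add: prime_gt_0_nat)
      then show ?thesis using sz \<open>p = 3\<close> by simp
    qed
    \<comment> \<open>Two odd numbers from 5 on have sum 10 or at least 12. If both are 5, then
      \<open>p2 = 5\<close>, and \<open>q\<close> is neither 5, which divides \<open>m\<close>, nor
      6; so \<open>q\<close> is at least 7 and makes up for the missing 2.\<close>
    moreover have "q1 + q2 \<ge> 12 \<or> q1 = 5 \<and> q2 = 5"
    proof -
      have "q1 \<ge> 5" "q2 \<ge> 5" using calculation p2 by linarith+
      moreover have "q1 \<noteq> 6" "q2 \<noteq> 6" using \<open>odd q1\<close> \<open>odd q2\<close> by auto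
      ultimately show ?thesis by linarith
    qed
    moreover have "q \<noteq> 6" using q(2) by auto
    ultimately have "size A + q \<ge> 3 * p + p2 + 1" using q(3) p2 by (elim disjE) linarith+
    then show ?thesis by blast
  qed
qed

text \<open>Now each of the other \<open>q - 1\<close> slices is counted with two terms. The two
  polygons of \<open>B\<close> must accommodate \<open>p - 1\<close> terms in the coset of
  \<open>a\<close> and \<open>p - 1\<close> in that of \<open>b\<close>. Two \<open>p\<close>-gons
  would leave two terms for \<open>A\<close>, and these are \<open>a\<close> and \<open>b\<close>,
  because a nonzero sum of two unit numbers determines them.\<close>

lemma sum_two_roots_even:
  assumes m: "admissible m" and E: "even_classified m"
    and A: "unity_mset m A" "even (size A)" "\<Sum>\<^sub># A = a + b" and ab: "a ^ m = 1" "b ^ m = 1"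
    and nz: "a + b \<noteq> 0" and q: "prime q" "odd q" "p2 \<le> q" "\<not> q dvd m"
  shows "A = {#a, b#} \<or> size A + 2 * q \<ge> 3 * p + p2 + 2"
proof (rule ccontr)
  assume neg: "\<not> ?thesis"
  note adm = admissibleD[OF m]
  have ab0: "a \<noteq> 0" "b \<noteq> 0" using ab adm(1) by (auto simp: power_0_left)
  have nrm: "norm z = 1" if "z ^ m = 1" for z :: complex
    using that adm(1) by (metis power_eq_1_iff zero_less_iff_neq_zero)
  have two: False if "size A = 2"
  proof -
    obtain c N where cN: "A = add_mset c N"
      using size_eq_Suc_imp_eq_union[of A 1] \<open>size A = 2\<close> by auto
    then obtain d where "N = {#d#}" using \<open>size A = 2\<close> size_1_singleton_mset[of N] by auto
    then have A': "A = {#c, d#}" using cN by simp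
    then show False using neg sum_of_two_unit_complex[of a b c d] A ab nz nrm by simp
  qed
  define B where "B = A + gon_rest b p + gon_rest a p"
  have sz: "size B = size A + (p - 1) + (p - 1)" using ab0 p_ge_3 by (simp add: B_def gon_rest)
  have "B \<noteq> {#}" using sz p_ge_3 by (auto simp: size_eq_0_iff_empty[symmetric] simp del: size_eq_0_iff_empty)
  moreover have "unity_mset m B" using A ab adm by (simp add: B_def unity_mset_gon_rest)
  moreover have "\<Sum>\<^sub># B = 0" using A ab0 p_ge_3 by (simp add: B_def gon_rest)
  moreover have "even (size B)" using sz A(2) odd_p by simp
  moreover have lt: "size B < 3 * p + p2" using sz neg p_ge_3 p2 q(3) by linarith
  ultimately have "is_two_gons m B \<or> 4 * p \<le> size B" using E unfolding even_classified_def by blast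
  moreover have "\<not> 4 * p \<le> size B" using sz neg p_ge_3 p2 q(3) by linarith
  ultimately obtain g h q1 q2 where gq: "prime q1" "q1 dvd m" "g \<noteq> 0" "prime q2" "q2 dvd m" "h \<noteq> 0"
    "B = gon g q1 + gon h q2" unfolding is_two_gons_def is_gon_def by blast
  have szB: "size B = q1 + q2" using gq by (simp add: prime_gt_0_nat)
  have not_pp: "\<not> (q1 = p \<and> q2 = p)"
  proof
    assume "q1 = p \<and> q2 = p"
    then have "size A = 2" using szB sz p_ge_3 by linarith
    then show False by (rule two)
  qed
  show False
  proof (cases "p = 3")
    case True
    \<comment> \<open>The bounds leave only \<open>q = p2 = 5\<close> and \<open>size A = 4\<close>.
      The two polygons then have 8 vertices together, so one is a pentagon, although
      \<open>q\<close> does not divide \<open>m\<close>.\<close>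
    have sum: "size A + 4 = q1 + q2" using szB sz True by simp
    have "size A \<noteq> 0" "size A \<noteq> 1" "size A \<noteq> 2" "size A \<noteq> 3" and A5: "size A \<noteq> 5" and "q \<noteq> 6"
      using A(2,3) nz two q(2) by auto
    then have ge: "size A \<ge> 4" "q \<noteq> 6" by linarith+
    have le: "size A + 2 * q \<le> 10 + p2" using neg True by linarith
    then have "q = 5" using ge q(3) p2 True by linarith
    then have "size A = 4" "p2 = 5" using le ge A5 q(3) p2 True by linarith+
    moreover have "q1 = 3 \<or> p2 \<le> q1" "q2 = 3 \<or> p2 \<le> q2" using adm(5) gq True by auto
    ultimately have "q1 = 5 \<or> q2 = 5" using sum by auto
    then show False using \<open>q = 5\<close> q(4) gq by auto
  next
    case False
    then have "p \<noteq> 4" "p \<noteq> 3" using odd_p by auto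
    then have p5: "p \<ge> 5" using p_ge_3 by linarith
    let ?F = "\<lambda>a. filter_mset (\<lambda>z. (z / a) ^ p = 1)"
    \<comment> \<open>If only one polygon is a \<open>p\<close>-gon, it is the one through
      \<open>a\<close> and also the one through \<open>b\<close>. Its coset then contains
      \<open>2 * (p - 1)\<close> terms of \<open>B\<close>, but the other polygon adds at most one
      to the \<open>p\<close> vertices.\<close>
    have key: False if B': "B = gon g p + gon h r" and r: "prime r" "r \<noteq> p" and gh: "g \<noteq> 0" "h \<noteq> 0" for g h r
    proof -
      have g_eq: "gon g p = gon c p" if c: "c \<noteq> 0" "gon_rest c p \<subseteq># B" for c
      proof (rule filter_gon_eq)
        show "?F c (gon g p) \<noteq> {#}"
        proof
          assume "?F c (gon g p) = {#}"
          then have "size (?F c B) \<le> 1"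
            using B' filter_gon_distinct_primes[OF prime_p r(1) _ c(1) gh(2)] r(2)
            by (simp del: filter_mset_eq_mempty_iff)
          moreover have "size (?F c (gon_rest c p)) \<le> size (?F c B)"
            using c(2) by (intro size_mset_mono multiset_filter_mono)
          ultimately show False using gon_rest[of c p] c(1) p5 by simp
        qed
      qed (use c gh p5 in auto)
      have "gon g p = gon a p" "gon g p = gon b p"
        using g_eq[of a] g_eq[of b] ab0 by (simp_all add: B_def)
      then have "gon b p = gon a p" by simp
      then have "(z / a) ^ p = 1" if "z \<in># gon_rest b p" for z
        using that mem_gon_iff[of a p z] ab0 p5 unfolding gon_rest_def by (metis in_diffD less_le_trans zero_less_numeral)
      then have "?F a (gon_rest b p) = filter_mset (\<lambda>_. True) (gon_rest b p)"
        by (intro filter_mset_cong) auto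
      then have "size (?F a B) \<ge> 2 * (p - 1)" using gon_rest[of a p] gon_rest[of b p] ab0 p5 by (simp add: B_def)
      moreover have "size (?F a B) \<le> p + 1"
        using B' filter_gon_distinct_primes[OF prime_p r(1) _ ab0(1) gh(2)] r(2)
          size_mset_mono[OF multiset_filter_subset, of "\<lambda>z. (z / a) ^ p = 1" "gon g p"] gh p5 by simp
      ultimately show False using p5 by linarith
    qed
    have "\<not> (q1 \<noteq> p \<and> q2 \<noteq> p)"
    proof
      assume "q1 \<noteq> p \<and> q2 \<noteq> p"
      then have "size (?F a (gon g q1)) + size (?F a (gon h q2)) \<le> 1 + 1"
        by (intro add_mono filter_gon_distinct_primes prime_p gq ab0) auto
      then have "size (?F a B) \<le> 1 + 1" using gq by simp
      moreover have "size (?F a B) \<ge> p - 1" using gon_rest[of a p] ab0 p5 by (simp add: B_def)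
      ultimately show False using p5 by linarith
    qed
    then show False using key[of g h q2] key[of h g q1] gq not_pp by (auto simp: add.commute)
  qed
qed

end

section \<open>Classification of short vanishing sums\<close>

lemma sum_singletons: "finite S \<Longrightarrow> (\<Sum>j\<in>S. {#f j#}) = image_mset f (mset_set S)"
  by (induction S rule: finite_induct) auto

lemma full_slices:
  assumes "prime q" "\<not> q dvd k" "a \<noteq> 0"
  shows "(\<Sum>j<q. image_mset ((*) (coset_rep q k j)) {#a#}) = gon a q"
proof -
  have q: "q > 0" using assms(1) by (rule prime_gt_0_nat)
  have "(\<Sum>j<q. image_mset ((*) (coset_rep q k j)) {#a#}) = image_mset (\<lambda>j. coset_rep q k j * a) (mset_set {..<q})"
    by (simp add: sum_singletons)
  also have "\<dots> = image_mset ((*) a) (image_mset (coset_rep q k) (mset_set {..<q}))"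
    by (simp add: image_mset.compositionality o_def mult.commute)
  also have "image_mset (coset_rep q k) (mset_set {..<q}) = mset_set {z. z ^ q = 1}"
    using coset_rep_bij[OF q assms(2)] by (simp add: bij_betw_def image_mset_mset_set)
  finally show ?thesis using assms(3) by (simp add: gon_eq_image)
qed

lemma slice_split:
  assumes "prime q" "k > 0" "unity_mset (q * k) A" "\<Sum>\<^sub># A = 0" "j < q" "\<Sum>\<^sub># (slice q k j A) = 0"
  obtains R where "A = image_mset ((*) (coset_rep q k j)) (slice q k j A) + R"
    "unity_mset (q * k) R" "\<Sum>\<^sub># R = 0" "size A = size (slice q k j A) + size R"
proof -
  let ?R = "\<Sum>i\<in>{..<q} - {j}. image_mset ((*) (coset_rep q k i)) (slice q k i A)"
  let ?S = "image_mset ((*) (coset_rep q k j)) (slice q k j A)"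
  have S0: "\<Sum>\<^sub># ?S = 0"
    using sum_mset_distrib_left[of "coset_rep q k j" "\<lambda>x. x" "slice q k j A"] assms(6) by simp
  have eq: "A = ?S + ?R"
    using assms(5) by (subst mset_eq_slices[OF assms(1-3)]) (rule sum.remove, auto)
  moreover have "unity_mset (q * k) ?R" using unity_mset_mono[OF assms(3), of ?R] eq
    by (metis mset_subset_eq_add_right)
  moreover have "\<Sum>\<^sub># ?R = 0"
    using arg_cong[OF eq, of "\<Sum>\<^sub>#"] assms(4) S0 by simp
  moreover have "size A = size (slice q k j A) + size ?R"
    using arg_cong[OF eq, of size] by simp
  ultimately show thesis by (rule that)
qed

context two_smallest_primes
begin

text \<open>A slice is split off such that the remainder, again a vanishing sum, is too short to be
  nonempty. Below \<open>3 * p\<close> any odd slice will do. From there on \<open>p\<close> may be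
  assumed not to divide the size; a slice of size not divisible by \<open>p\<close> then involves a
  polygon with at least \<open>p2\<close> vertices.\<close>

lemma odd_classified_vanishing_slices:
  assumes m: "admissible m" "m = q * k" "prime q" and k: "admissible k" "odd_classified k" "even_classified k"
    and A: "unity_mset m A" "\<Sum>\<^sub># A = 0" "odd (size A)" "size A < 2 * p + p2"
    and zero: "\<And>j. j < q \<Longrightarrow> \<Sum>\<^sub># (slice q k j A) = 0"
  shows "is_gon m A \<or> p dvd size A \<and> 3 * p \<le> size A"
proof (rule ccontr)
  assume neg: "\<not> ?thesis"
  note adm = admissibleD[OF m(1)] and admk = admissibleD[OF k(1)]
  define n where "n j = size (slice q k j A)" for j
  have u: "unity_mset (q * k) A" using A m by simp
  have sz: "size A = (\<Sum>j<q. n j)"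
    unfolding n_def by (rule size_eq_slices[OF m(3) admk(1) u])
  have uk: "unity_mset k (slice q k j A)" for j by (rule unity_mset_slice)
  have rest: "size R \<ge> (if even (size R) then 2 * p else p)" if "unity_mset m R" "\<Sum>\<^sub># R = 0" "R \<noteq> {#}" for R
    by (rule vanishing_size[OF adm(1,2,4) odd_p p_ge_3 that])
  have only: "is_gon m A" if "j < q" "is_gon k (slice q k j A)" "even (size R)" "size R < 2 * p"
    "A = image_mset ((*) (coset_rep q k j)) (slice q k j A) + R" "unity_mset m R" "\<Sum>\<^sub># R = 0" for j R
  proof -
    have "R = {#}" using rest[OF that(6,7)] that(3,4) by (cases "R = {#}") auto
    then have "A = image_mset ((*) (coset_rep q k j)) (slice q k j A)" using that(5) by simp
    then show ?thesis using is_gon_image[OF that(2) coset_rep_nonzero, of q q k j] m(2) by simp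
  qed
  have Ok: "is_gon k (slice q k j A) \<or> p dvd n j \<and> 3 * p \<le> n j" if "j < q" "odd (n j)" for j
  proof -
    have "n j \<le> size A" using sum_ge_single[of j q 0 n] that sz by simp
    then show ?thesis using k(2) uk zero[OF that(1)] that(2) A(4) unfolding odd_classified_def n_def by auto
  qed
  show False
  proof (cases "size A < 3 * p")
    case True
    obtain j where j: "j < q" "odd (n j)"
    proof -
      have "\<not> (\<forall>j<q. even (n j))"
      proof
        assume "\<forall>j<q. even (n j)"
        then have "even (\<Sum>j<q. n j)" by (intro dvd_sum) auto
        then show False using sz A(3) by simp
      qed
      then show thesis using that by blast
    qed
    obtain R where R: "A = image_mset ((*) (coset_rep q k j)) (slice q k j A) + R"
      "unity_mset m R" "\<Sum>\<^sub># R = 0" "size A = n j + size R"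
      using slice_split[OF m(3) admk(1) u A(2) j(1) zero[OF j(1)], folded m(2)] unfolding n_def by blast
    have "slice q k j A \<noteq> {#}" using j(2) by (auto simp: n_def)
    then have "n j \<ge> p" using vanishing_size[OF admk(1,2,4) odd_p p_ge_3 uk zero[OF j(1)]] j(2)
      by (simp add: n_def)
    moreover have "even (size R)" using R(4) A(3) j(2) by auto
    moreover have "is_gon k (slice q k j A)" using Ok[OF j] R(4) True by linarith
    moreover have "size R < 2 * p" using R(4) True calculation(1) by linarith
    ultimately show False using only[OF j(1), of R] R neg by blast
  next
    case False
    then have ndvd: "\<not> p dvd size A" using neg by simp
    obtain j where j: "j < q" "\<not> p dvd n j"
    proof -
      have "\<not> (\<forall>j<q. p dvd n j)" using ndvd sz by (metis dvd_sum lessThan_iff)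
      then show thesis using that by blast
    qed
    obtain R where R: "A = image_mset ((*) (coset_rep q k j)) (slice q k j A) + R"
      "unity_mset m R" "\<Sum>\<^sub># R = 0" "size A = n j + size R"
      using slice_split[OF m(3) admk(1) u A(2) j(1) zero[OF j(1)], folded m(2)] unfolding n_def by blast
    show False
    proof (cases "even (n j)")
      case True
      then have "odd (size R)" using R(4) A(3) by auto
      then have "size R \<ge> p" using rest[of R] R by (cases "R = {#}") auto
      have "slice q k j A \<noteq> {#}" using j(2) by (auto simp: n_def)
      moreover have "n j < 3 * p + p2" using A(4) R(4) by linarith
      ultimately have "is_two_gons k (slice q k j A)"
        using k(3) uk zero[OF j(1)] True j(2) unfolding even_classified_def n_def by blast
      then obtain q1 q2 where "prime q1" "q1 dvd k" "prime q2" "q2 dvd k" "n j = q1 + q2"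
        unfolding is_two_gons_def n_def using size_is_gon by (metis size_union)
      moreover from this have "q1 \<noteq> p \<or> q2 \<noteq> p" using j(2) by auto
      ultimately have "n j \<ge> p + p2" using admk(4,5) p2 by (metis add.commute add_mono)
      then show False using R(4) \<open>size R \<ge> p\<close> A(4) by linarith
    next
      case odd: False
      then have gon: "is_gon k (slice q k j A)" using Ok[OF j(1)] j(2) by blast
      then have "n j \<ge> p2" using size_is_gon admk(5) j(2) unfolding n_def by (metis dvd_refl)
      then have "size R < 2 * p" using R(4) A(4) by linarith
      moreover have "even (size R)" using R(4) A(3) odd by auto
      ultimately show False using only[OF j(1) gon] R neg by auto
    qed
  qed
qed

text \<open>As for odd sizes, but the remainder can also be odd; being shorter than
  \<open>3 * p\<close>, it is then one polygon by the odd classification for the same order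
  \<open>m\<close>.\<close>

lemma even_classified_vanishing_slices:
  assumes m: "admissible m" "m = q * k" "prime q" "odd_classified m"
    and k: "admissible k" "odd_classified k" "even_classified k"
    and A: "unity_mset m A" "\<Sum>\<^sub># A = 0" "even (size A)" "A \<noteq> {#}" "size A < 3 * p + p2"
    and zero: "\<And>j. j < q \<Longrightarrow> \<Sum>\<^sub># (slice q k j A) = 0"
  shows "is_two_gons m A \<or> p dvd size A \<and> 4 * p \<le> size A"
proof (rule ccontr)
  assume neg: "\<not> ?thesis"
  note adm = admissibleD[OF m(1)] and admk = admissibleD[OF k(1)]
  define n where "n j = size (slice q k j A)" for j
  have u: "unity_mset (q * k) A" using A m by simp
  have sz: "size A = (\<Sum>j<q. n j)"
    unfolding n_def by (rule size_eq_slices[OF m(3) admk(1) u])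
  have uk: "unity_mset k (slice q k j A)" for j by (rule unity_mset_slice)
  have rest: "size R \<ge> (if even (size R) then 2 * p else p)" if "unity_mset m R" "\<Sum>\<^sub># R = 0" "R \<noteq> {#}" for R
    by (rule vanishing_size[OF adm(1,2,4) odd_p p_ge_3 that])
  have both_even: "is_two_gons m A" if "j < q" "is_two_gons k (slice q k j A)" "even (size R)" "size R < 2 * p"
    "A = image_mset ((*) (coset_rep q k j)) (slice q k j A) + R" "unity_mset m R" "\<Sum>\<^sub># R = 0" for j R
  proof -
    have "R = {#}" using rest[OF that(6,7)] that(3,4) by (cases "R = {#}") auto
    then have "A = image_mset ((*) (coset_rep q k j)) (slice q k j A)" using that(5) by simp
    then show ?thesis using is_two_gons_image[OF that(2) coset_rep_nonzero, of q q k j] m(2) by simp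
  qed
  have both_odd: "is_two_gons m A" if "j < q" "is_gon k (slice q k j A)" "odd (size R)" "size R < 3 * p"
    "A = image_mset ((*) (coset_rep q k j)) (slice q k j A) + R" "unity_mset m R" "\<Sum>\<^sub># R = 0" for j R
  proof -
    have "is_gon m R" using m(4) that p2 unfolding odd_classified_def by fastforce
    moreover have "is_gon m (image_mset ((*) (coset_rep q k j)) (slice q k j A))"
      using is_gon_image[OF that(2) coset_rep_nonzero, of q q k j] m(2) by simp
    ultimately show ?thesis using that(5) unfolding is_two_gons_def by blast
  qed
  have vk: "n j \<ge> (if even (n j) then 2 * p else p)" if "j < q" "n j \<noteq> 0" for j
    unfolding n_def using that(2)
    by (intro vanishing_size[OF admk(1,2,4) odd_p p_ge_3 uk zero[OF that(1)]]) (auto simp: n_def)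
  have Ok: "is_gon k (slice q k j A) \<or> p dvd n j \<and> 3 * p \<le> n j" if "j < q" "odd (n j)" "n j < 2 * p + p2" for j
    using k(2) uk zero[OF that(1)] that(2,3) unfolding odd_classified_def n_def by auto
  have Ek: "is_two_gons k (slice q k j A) \<or> p dvd n j \<and> 4 * p \<le> n j" if "j < q" "even (n j)" "n j \<noteq> 0" for j
  proof -
    have "n j \<le> size A" using sum_ge_single[of j q 0 n] that sz by simp
    then show ?thesis using k(3) uk[of j] zero[OF that(1)] that(2,3) A(5) unfolding even_classified_def n_def
      by (metis le_less_trans size_empty)
  qed
  show False
  proof (cases "size A < 4 * p")
    case True
    have "size A \<noteq> 0" using A(4) by simp
    then obtain j where j: "j < q" "n j \<noteq> 0" unfolding sz by (rule sum_nonzeroE)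
    obtain R where R: "A = image_mset ((*) (coset_rep q k j)) (slice q k j A) + R"
      "unity_mset m R" "\<Sum>\<^sub># R = 0" "size A = n j + size R"
      using slice_split[OF m(3) admk(1) u A(2) j(1) zero[OF j(1)], folded m(2)] unfolding n_def by blast
    show False
    proof (cases "even (n j)")
      case even: True
      then have "n j \<ge> 2 * p" using vk[OF j] by simp
      then have "size R < 2 * p" "is_two_gons k (slice q k j A)" using True R(4) Ek[OF j(1) even j(2)] by linarith+
      moreover have "even (size R)" using even R(4) A(3) by auto
      ultimately show False using both_even[OF j(1)] R neg by blast
    next
      case odd: False
      then have "n j \<ge> p" using vk[OF j] by simp
      have oR: "odd (size R)" using odd R(4) A(3) by auto
      then have "size R \<ge> p" using rest[of R] R by (cases "R = {#}") auto
      then have "is_gon k (slice q k j A)" using Ok[OF j(1) odd] R(4) True p2 by linarith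
      moreover have "size R < 3 * p" using \<open>n j \<ge> p\<close> R(4) True by linarith
      ultimately show False using both_odd[OF j(1) _ oR] R neg by blast
    qed
  next
    case False
    then have ndvd: "\<not> p dvd size A" using neg by simp
    obtain j where j: "j < q" "\<not> p dvd n j"
    proof -
      have "\<not> (\<forall>j<q. p dvd n j)" using ndvd sz by (metis dvd_sum lessThan_iff)
      then show thesis using that by blast
    qed
    have nz: "n j \<noteq> 0" using j(2) by (metis dvd_0_right)
    obtain R where R: "A = image_mset ((*) (coset_rep q k j)) (slice q k j A) + R"
      "unity_mset m R" "\<Sum>\<^sub># R = 0" "size A = n j + size R"
      using slice_split[OF m(3) admk(1) u A(2) j(1) zero[OF j(1)], folded m(2)] unfolding n_def by blast
    show False
    proof (cases "even (n j)")
      case True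
      then have two: "is_two_gons k (slice q k j A)" using Ek[OF j(1) True nz] j(2) by blast
      then obtain q1 q2 where "prime q1" "q1 dvd k" "prime q2" "q2 dvd k" "n j = q1 + q2"
        unfolding is_two_gons_def n_def using size_is_gon by (metis size_union)
      moreover from this have "q1 \<noteq> p \<or> q2 \<noteq> p" using j(2) by auto
      ultimately have "n j \<ge> p + p2" using admk(4,5) p2 by (metis add.commute add_mono)
      then have "size R < 2 * p" using R(4) A(5) by linarith
      moreover have "even (size R)" using True R(4) A(3) by auto
      ultimately show False using both_even[OF j(1) two] R neg by blast
    next
      case odd: False
      have oR: "odd (size R)" using odd R(4) A(3) by auto
      then have "size R \<ge> p" using rest[of R] R by (cases "R = {#}") auto
      then have gon: "is_gon k (slice q k j A)" using Ok[OF j(1) odd] R(4) A(5) j(2) by linarith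
      then have "n j \<ge> p2" using size_is_gon admk(5) j(2) unfolding n_def by (metis dvd_refl)
      then have "size R < 3 * p" using R(4) A(5) by linarith
      then show False using both_odd[OF j(1) gon oR] R neg by blast
    qed
  qed
qed

text \<open>For \<open>k = 1\<close> every slice consists of ones, so equal sums mean equal
  multiplicities of all \<open>p\<close>-th roots of unity.\<close>

lemma classified_prime:
  assumes "unity_mset p A" "\<Sum>\<^sub># A = 0"
  shows "\<exists>N. size A = p * N \<and> A = repeat_mset N (gon 1 p)"
proof -
  have u: "unity_mset (p * 1) A" using assms by simp
  obtain c where c: "\<And>j. j < p \<Longrightarrow> \<Sum>\<^sub># (slice p 1 j A) = c"
    using slices_sum_const[OF prime_p _ u, of "{#}"] assms by auto
  define N where "N = size (slice p 1 0 A)"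
  have "slice p 1 j A = repeat_mset N {#1#}" if "j < p" for j
  proof -
    have "\<Sum>\<^sub># (slice p 1 i A) = of_nat (size (slice p 1 i A))" for i
      by (intro unity_mset_1 unity_mset_slice)
    then have "size (slice p 1 j A) = N" using c[OF that] c[of 0] p_ge_3 unfolding N_def
      by (metis gr0I not_numeral_le_zero of_nat_eq_iff)
    moreover have "\<forall>z\<in>#slice p 1 j A. z = 1" using unity_mset_slice[of 1 p j A] by (simp add: unity_mset_def)
    ultimately have "slice p 1 j A = replicate_mset N 1"
      by (metis (mono_tags, lifting) set_mset_subset_singletonD insertI1 subsetI singleton_iff)
    then show ?thesis by (simp add: repeat_mset_replicate_mset)
  qed
  then have "A = (\<Sum>j<p. image_mset ((*) (coset_rep p 1 j)) (repeat_mset N {#1#}))"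
    using mset_eq_slices[OF prime_p _ u] by simp
  also have "\<dots> = repeat_mset N (\<Sum>j<p. image_mset ((*) (coset_rep p 1 j)) {#1#})"
  proof -
    have "(\<Sum>j\<in>S. image_mset ((*) (coset_rep p 1 j)) (repeat_mset N {#1#})) =
      repeat_mset N (\<Sum>j\<in>S. image_mset ((*) (coset_rep p 1 j)) {#1#})" if "finite S" for S
      using that by induction simp_all
    then show ?thesis by blast
  qed
  also have "\<dots> = repeat_mset N (gon 1 p)"
    using full_slices[OF prime_p, of 1 1] p_ge_3 by simp
  finally have "A = repeat_mset N (gon 1 p)" .
  moreover from arg_cong[OF this, of size] have "size A = p * N" using p_ge_3 by simp
  ultimately show ?thesis by blast
qed

text \<open>No slice is empty. If one is a single term \<open>a\<close>, parity and size force all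
  of them to be \<open>{#a#}\<close>, which is a \<open>q\<close>-gon; otherwise each has at least
  two terms and the total is too large.\<close>

lemma odd_classified_nonvanishing_slices:
  assumes q: "prime q" "odd q" "p2 \<le> q" "\<not> q dvd k" and k: "admissible k" "odd_classified k"
    and A: "unity_mset (q * k) A" "odd (size A)" "size A < 2 * p + p2"
    and c: "\<And>j. j < q \<Longrightarrow> \<Sum>\<^sub># (slice q k j A) = c" "c \<noteq> 0"
  shows "is_gon (q * k) A"
proof -
  note admk = admissibleD[OF k(1)]
  define n where "n j = size (slice q k j A)" for j
  have sz: "size A = (\<Sum>j<q. n j)"
    unfolding n_def by (rule size_eq_slices[OF q(1) admk(1) A(1)])
  have uk: "unity_mset k (slice q k j A)" for j by (rule unity_mset_slice)
  have n1: "n j \<ge> 1" if "j < q" for j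
    using c(1)[OF that] c(2) by (cases "slice q k j A = {#}") (auto simp: n_def Suc_le_eq nonempty_has_size)
  have T: "n i + n j \<ge> p + 2" if "i < q" "j < q" "odd (n i + n j)" for i j
  proof -
    have "slice q k i A \<noteq> {#}" "slice q k j A \<noteq> {#}" using n1[OF that(1)] n1[OF that(2)] by (auto simp: n_def)
    then show ?thesis
      using odd_relation_size[OF admk(1,2,4) odd_p p_ge_3 uk[of i] uk[of j]] c(1)[OF that(1)] c(1)[OF that(2)] that(3)
      by (simp add: n_def)
  qed
  show ?thesis
  proof (cases "\<exists>j<q. n j = 1")
    case True
    then obtain j a where j: "j < q" "slice q k j A = {#a#}" unfolding n_def by (metis size_1_singleton_mset)
    have a: "c = a" "a ^ k = 1" using c(1)[OF j(1)] j(2) uk[of j] by simp_all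
    have nj: "n j = 1" using j by (simp add: n_def)
    have odd: "odd (n i)" if i: "i < q" for i
    proof
      assume ev: "even (n i)"
      \<comment> \<open>The total and \<open>q\<close> are odd, so the slices of even size are even
        in number. Two of them have at least \<open>p + 1\<close> terms each, which with the other
        \<open>q - 2\<close> slices makes \<open>2 * p + q\<close>.\<close>
      have "\<exists>l<q. l \<noteq> i \<and> even (n l)"
      proof (rule ccontr)
        assume "\<not> ?thesis"
        then have "even (sum n ({..<q} - {i})) \<longleftrightarrow> even (card ({..<q} - {i}))"
          by (intro even_sum_odd_terms) auto
        moreover have "size A = n i + sum n ({..<q} - {i})" using i sz by (simp add: sum.remove[of _ i])
        ultimately show False using ev A(2) q(2) i by simp
      qed
      then obtain l where l: "l < q" "l \<noteq> i" "even (n l)" by blast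
      have "n i + 1 \<ge> p + 2" "n l + 1 \<ge> p + 2"
        using T[OF i j(1)] T[OF l(1) j(1)] ev l(3) nj by simp_all
      then show False using sum_ge_pair[OF i l(1) l(2)[symmetric], of 1 n] n1 sz A(3) q(3) by simp
    qed
    have "slice q k i A = {#a#}" if i: "i < q" for i
    proof -
      have "\<not> n i \<ge> 2 * p + 1" using sum_ge_single[OF i, of 1 n] n1 sz A(3) q(3) by auto
      then show ?thesis using sum_one_root_odd[OF k uk, of i a] odd[OF i] c(1)[OF i] a by (simp add: n_def)
    qed
    then have "A = (\<Sum>i<q. image_mset ((*) (coset_rep q k i)) {#a#})"
      using mset_eq_slices[OF q(1) admk(1) A(1)] by simp
    then have "A = gon a q" using full_slices[OF q(1,4)] a c(2) by simp
    then show ?thesis using q(1) a c(2) unfolding is_gon_def by (metis dvd_triv_left)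
  next
    case False
    have n2: "n j \<ge> 2" if "j < q" for j
    proof -
      have "n j \<noteq> 1" using False that by blast
      then show ?thesis using n1[OF that] by linarith
    qed
    have False
    proof (cases "\<forall>i<q. \<forall>j<q. even (n i) = even (n j)")
      case True
      have "n j \<ge> 3" if "j < q" for j
      proof -
        have "odd (n j)" using even_sum_same_parity[OF q(2) True that] sz A(2) by simp
        then have "n j \<noteq> 2" by auto
        then show ?thesis using n2[OF that] by linarith
      qed
      then have "(\<Sum>j<q. n j) \<ge> q * 3" using sum_mono[of "{..<q}" "\<lambda>_. 3" n] by simp
      then show False using sz A(3) q(3) p2 by linarith
    next
      case False
      then obtain i j where ij: "i < q" "j < q" "even (n i) \<noteq> even (n j)" by blast
      then have "i \<noteq> j" "odd (n i + n j)" by auto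
      then show False using sum_ge_pair[OF ij(1,2) \<open>i \<noteq> j\<close>, of 2 n] n2 T[OF ij(1,2)] sz A(3) q(3) p2 by simp
    qed
    then show ?thesis ..
  qed
qed

text \<open>If some slice is a single term \<open>a\<close>, exactly one slice has even size: it is
  \<open>a\<close> plus a polygon, the others are \<open>{#a#}\<close>, and together they form a
  \<open>q\<close>-gon and that polygon, rotated. Otherwise all slices equal one pair
  \<open>{#x, y#}\<close> and form two \<open>q\<close>-gons.\<close>

lemma even_classified_nonvanishing_slices:
  assumes q: "prime q" "odd q" "p2 \<le> q" "\<not> q dvd k"
    and k: "admissible k" "odd_classified k" "even_classified k"
    and A: "unity_mset (q * k) A" "even (size A)" "size A < 3 * p + p2"
    and c: "\<And>j. j < q \<Longrightarrow> \<Sum>\<^sub># (slice q k j A) = c" "c \<noteq> 0"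
  shows "is_two_gons (q * k) A"
proof -
  note admk = admissibleD[OF k(1)]
  define n where "n j = size (slice q k j A)" for j
  have sz: "size A = (\<Sum>j<q. n j)"
    unfolding n_def by (rule size_eq_slices[OF q(1) admk(1) A(1)])
  have uk: "unity_mset k (slice q k j A)" for j by (rule unity_mset_slice)
  have n1: "n j \<ge> 1" if "j < q" for j
    using c(1)[OF that] c(2) by (cases "slice q k j A = {#}") (auto simp: n_def Suc_le_eq nonempty_has_size)
  have T: "n i + n j \<ge> p + 2" if "i < q" "j < q" "odd (n i + n j)" for i j
  proof -
    have "slice q k i A \<noteq> {#}" "slice q k j A \<noteq> {#}" using n1[OF that(1)] n1[OF that(2)] by (auto simp: n_def)
    then show ?thesis
      using odd_relation_size[OF admk(1,2,4) odd_p p_ge_3 uk[of i] uk[of j]] c(1)[OF that(1)] c(1)[OF that(2)] that(3)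
      by (simp add: n_def)
  qed
  have gon_q: "is_gon (q * k) (gon a q)" if "a \<noteq> 0" for a
    using q(1) that unfolding is_gon_def by (metis dvd_triv_left)
  show ?thesis
  proof (cases "\<exists>j<q. n j = 1")
    case True
    then obtain j a where j: "j < q" "slice q k j A = {#a#}" unfolding n_def by (metis size_1_singleton_mset)
    have a: "c = a" "a ^ k = 1" using c(1)[OF j(1)] j(2) uk[of j] by simp_all
    have nj: "n j = 1" using j by (simp add: n_def)
    have big: "n i \<ge> p + 1" if "i < q" "even (n i)" for i
      using T[OF that(1) j(1)] that(2) nj by simp
    obtain i where i: "i < q" "even (n i)"
    proof -
      have "\<not> (\<forall>i<q. odd (n i))" using even_sum_odd_terms[of "{..<q}" n] sz A(2) q(2) by auto
      then show thesis using that by blast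
    qed
    have odd: "odd (n l)" if l: "l < q" "l \<noteq> i" for l
    proof
      assume ev: "even (n l)"
      \<comment> \<open>The total is even and \<open>q\<close> odd, so the slices of even size are
        odd in number. Three of them give at least \<open>3 * (p + 1) + (q - 3)\<close> terms, which
        is too many.\<close>
      have "\<exists>r<q. r \<noteq> i \<and> r \<noteq> l \<and> even (n r)"
      proof (rule ccontr)
        assume "\<not> ?thesis"
        then have "even (sum n ({..<q} - {i, l})) \<longleftrightarrow> even (card ({..<q} - {i, l}))"
          by (intro even_sum_odd_terms) auto
        moreover have "card ({..<q} - {i, l}) = q - 2" using i l by (simp add: card_Diff_subset)
        moreover have "odd (q - 2)" using q(2) prime_ge_2_nat[OF q(1)] by simp
        ultimately have "odd (sum n ({..<q} - {i, l}))" by metis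
        moreover have "(\<Sum>j<q. n j) = sum n ({..<q} - {i, l}) + sum n {i, l}"
          using i l by (intro sum.subset_diff) auto
        moreover have "sum n {i, l} = n i + n l" using l(2) by simp
        ultimately show False using ev i(2) A(2) sz by (metis even_add)
      qed
      then obtain r where r: "r < q" "r \<noteq> i" "r \<noteq> l" "even (n r)" by blast
      then show False
        using sum_ge_triple[of i q l r 1 n] i l big[of i] big[OF l(1) ev] big[of r] n1 sz A(3) q(3) by auto
    qed
    have ij: "i \<noteq> j" using i nj by auto
    have one: "slice q k l A = {#a#}" if l: "l < q" "l \<noteq> i" for l
    proof -
      have "\<not> n l \<ge> 2 * p + 1"
        using sum_ge_pair[OF l(1) i(1) l(2), of 1 n] big[OF i] n1 sz A(3) q(3) by auto
      then show ?thesis using sum_one_root_odd[OF k(1,2) uk, of l a] odd[OF l] c(1)[OF l(1)] a by (simp add: n_def)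
    qed
    have ni: "n i + q \<le> size A + 1" using sum_ge_single[OF i(1), of 1 n] n1 sz by simp
    have "(\<exists>C. is_gon k C \<and> slice q k i A = add_mset a C) \<or> size (slice q k i A) + q \<ge> 3 * p + p2 + 1"
    proof (rule sum_one_root_even[OF k(1,3) uk _ _ a(2) q])
      show "size (slice q k i A) + p \<le> 4 * p" using ni A(3) q(3) by (simp add: n_def)
    qed (use i c(1)[OF i(1)] a in \<open>auto simp: n_def\<close>)
    then obtain C where C: "is_gon k C" "slice q k i A = {#a#} + C" using ni A(3) by (auto simp: n_def)
    have a0: "a \<noteq> 0" using a c(2) by simp
    have "A = (\<Sum>l<q. image_mset ((*) (coset_rep q k l)) (slice q k l A))"
      by (rule mset_eq_slices[OF q(1) admk(1) A(1)])
    also have "\<dots> = (\<Sum>l<q. image_mset ((*) (coset_rep q k l)) {#a#}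
        + (if l = i then image_mset ((*) (coset_rep q k i)) C else {#}))"
      by (intro sum.cong) (use one C in auto)
    also have "\<dots> = gon a q + image_mset ((*) (coset_rep q k i)) C"
      unfolding sum.distrib full_slices[OF q(1,4) a0] using i(1) by simp
    finally show ?thesis using gon_q[of a] is_gon_image[OF C(1) coset_rep_nonzero] a c(2)
      unfolding is_two_gons_def by blast
  next
    case False
    have n2: "n j \<ge> 2" if "j < q" for j
    proof -
      have "n j \<noteq> 1" using False that by blast
      then show ?thesis using n1[OF that] by linarith
    qed
    have n3: "n j \<ge> 3" if "j < q" "odd (n j)" for j
    proof -
      have "n j \<noteq> 2" using that(2) by auto
      then show ?thesis using n2[OF that(1)] by linarith
    qed
    have all_even: "even (n i)" if i: "i < q" for i
    proof (rule ccontr)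
      assume oi: "odd (n i)"
      have "\<exists>l<q. l \<noteq> i \<and> odd (n l)"
      proof (rule ccontr)
        assume "\<not> ?thesis"
        then have "even (sum n ({..<q} - {i}))" by (intro dvd_sum) auto
        moreover have "size A = n i + sum n ({..<q} - {i})" using i sz by (simp add: sum.remove[of _ i])
        ultimately show False using oi A(2) by simp
      qed
      then obtain l where l: "l < q" "l \<noteq> i" "odd (n l)" by blast
      obtain e where e: "e < q" "even (n e)"
      proof -
        have "\<not> (\<forall>i<q. odd (n i))" using even_sum_odd_terms[of "{..<q}" n] sz A(2) q(2) by auto
        then show thesis using that by blast
      qed
      show False
      \<comment> \<open>A slice with two terms forces \<open>p + 2\<close> terms in each of the two
        odd slices; without such a slice all slices have at least three terms. Either way the total
        exceeds the bound.\<close>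
      proof (cases "\<exists>f<q. n f = 2")
        case True
        then obtain f where f: "f < q" "n f = 2" by blast
        then obtain x y where xy: "slice q k f A = {#x, y#}"
        proof -
          have "size (slice q k f A) = Suc 1" using f(2) by (simp add: n_def)
          then obtain x N where "slice q k f A = add_mset x N" "size N = 1"
            by (metis size_eq_Suc_imp_eq_union size_add_mset Suc_inject)
          then show thesis using that by (metis size_1_singleton_mset)
        qed
        have xy1: "c = x + y" "x ^ k = 1" "y ^ k = 1" using c(1)[OF f(1)] xy uk[of f] by simp_all
        have "n g \<ge> p + 2" if "g < q" "odd (n g)" for g
          using sum_two_roots_odd[OF k(1,2) uk, of g x y] that c(1)[OF that(1)] xy1 by (simp add: n_def)
        from this[OF i oi] this[OF l(1,3)] show False
          using sum_ge_pair[OF i l(1) l(2)[symmetric], of 2 n] n2 sz A(3) q(3) p2 by simp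
      next
        case no2: False
        have n4: "n g \<ge> 4" if "g < q" "even (n g)" for g
        proof -
          have "n g \<noteq> 2" "n g \<noteq> 3" using no2 that by auto
          then show ?thesis using n2[OF that(1)] by linarith
        qed
        have "n g \<ge> 3" if "g < q" for g using n3[OF that] n4[OF that] by linarith
        moreover have "e \<noteq> i" "odd (n e + n i)" using e oi by auto
        ultimately show False
          using sum_ge_pair[OF e(1) i, of 3 n] T[OF e(1) i] sz A(3) q(3) p2 by simp
      qed
    qed
    obtain f where f: "f < q" "n f = 2"
    proof -
      have "\<not> (\<forall>f<q. n f \<noteq> 2)"
      proof
        assume no2: "\<forall>f<q. n f \<noteq> 2"
        have "n g \<ge> 4" if "g < q" for g
        proof -
          have "n g \<noteq> 2" "n g \<noteq> 3" using no2 all_even[OF that] that by auto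
          then show ?thesis using n2[OF that] by linarith
        qed
        then have "(\<Sum>j<q. n j) \<ge> q * 4" using sum_mono[of "{..<q}" "\<lambda>_. 4" n] by simp
        then show False using sz A(3) q(3) p2 by linarith
      qed
      then show thesis using that by blast
    qed
    obtain x y where xy: "slice q k f A = {#x, y#}"
    proof -
      have "size (slice q k f A) = Suc 1" using f(2) by (simp add: n_def)
      then obtain x N where "slice q k f A = add_mset x N" "size N = 1"
        by (metis size_eq_Suc_imp_eq_union size_add_mset Suc_inject)
      then show thesis using that by (metis size_1_singleton_mset)
    qed
    have xy1: "c = x + y" "x ^ k = 1" "y ^ k = 1" using c(1)[OF f(1)] xy uk[of f] by simp_all
    have xy0: "x \<noteq> 0" "y \<noteq> 0" using xy1 admk(1) by (auto simp: power_0_left)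
    have all_xy: "slice q k i A = {#x, y#}" if i: "i < q" for i
    proof -
      have "slice q k i A = {#x, y#} \<or> size (slice q k i A) + 2 * q \<ge> 3 * p + p2 + 2"
        using all_even[OF i] c(1)[OF i] c(2) xy1(1)
        by (intro sum_two_roots_even[OF k(1,3) uk _ _ xy1(2,3) _ q]) (simp_all add: n_def)
      moreover have "n i + q * 2 \<le> size A + 2" using sum_ge_single[OF i, of 2 n] n2 sz by simp
      ultimately show ?thesis using A(3) by (auto simp: n_def)
    qed
    have "A = (\<Sum>i<q. image_mset ((*) (coset_rep q k i)) {#x#} + image_mset ((*) (coset_rep q k i)) {#y#})"
      using mset_eq_slices[OF q(1) admk(1) A(1)] all_xy by (simp add: add_mset_commute)
    also have "\<dots> = gon x q + gon y q"
      unfolding sum.distrib using full_slices[OF q(1,4)] xy0 by simp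
    finally show ?thesis using gon_q xy0 unfolding is_two_gons_def by blast
  qed
qed

theorem vanishing_sums_classified:
  assumes "admissible m"
  shows "odd_classified m \<and> even_classified m"
  using assms
proof (induction m rule: less_induct)
  case (less m)
  note adm = admissibleD[OF less.prems]
  \<comment> \<open>The prime \<open>p\<close> is removed only when no other prime is left, so that
    \<open>p\<close> still divides \<open>k\<close> unless \<open>m = p\<close>.\<close>
  obtain q where q: "prime q" "q dvd m" and qp: "q = p \<Longrightarrow> (\<forall>r. prime r \<longrightarrow> r dvd m \<longrightarrow> r = p)"
  proof (cases "\<exists>r. prime r \<and> r dvd m \<and> r \<noteq> p")
    case True
    then show thesis using that by blast
  next
    case False
    then show thesis using that[of p] prime_p adm(3) by blast
  qed
  obtain k where m: "m = q * k" using q(2) by blast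
  have k0: "k > 0" "k < m" using adm(1) m prime_gt_1_nat[OF q(1)] by auto
  show ?case
  proof (cases "m = p")
    case True
    have szN: thesis if "unity_mset m A" "\<Sum>\<^sub># A = 0" "\<And>N. size A = p * N \<Longrightarrow> A = repeat_mset N (gon 1 p) \<Longrightarrow> thesis" for A thesis
      using classified_prime[of A] that True by blast
    have g: "is_gon m (gon 1 p)" using True prime_p unfolding is_gon_def by (metis dvd_refl zero_neq_one)
    have "odd_classified m"
      unfolding odd_classified_def
    proof (intro allI impI)
      fix A assume A: "unity_mset m A" "\<Sum>\<^sub># A = 0" "odd (size A)"
      obtain N where N: "size A = p * N" "A = repeat_mset N (gon 1 p)" using szN[OF A(1,2)] by blast
      then have "odd N" using A(3) by auto
      then consider "N = 1" | "N \<ge> 3" by (cases "N \<ge> 3") (auto simp: not_le less_Suc_eq numeral_3_eq_3)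
      then show "is_gon m A \<or> p dvd size A \<and> 3 * p \<le> size A" using N g by cases auto
    qed
    moreover have "even_classified m"
      unfolding even_classified_def
    proof (intro allI impI)
      fix A assume A: "unity_mset m A" "\<Sum>\<^sub># A = 0" "even (size A)" "A \<noteq> {#}"
      obtain N where N: "size A = p * N" "A = repeat_mset N (gon 1 p)" using szN[OF A(1,2)] by blast
      have "N \<noteq> 0" using A(4) N(2) by (metis repeat_mset_0)
      moreover have "even N" using A(3) N(1) odd_p by simp
      ultimately consider "N = 2" | "N \<ge> 4"
        by (cases "N = 1 \<or> N = 3") (force, force)
      then show "is_two_gons m A \<or> p dvd size A \<and> 4 * p \<le> size A"
      proof cases
        case 1
        then have "A = gon 1 p + gon 1 p" using N by (simp add: numeral_2_eq_2)
        then show ?thesis using g unfolding is_two_gons_def by blast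
      qed (use N in auto)
    qed
    ultimately show ?thesis ..
  next
    case False
    have "p dvd k"
    proof (cases "q = p")
      case True
      then have "k \<noteq> 1" using False m by auto
      then obtain r where "prime r" "r dvd k" using prime_factor_nat by blast
      then show ?thesis using qp[OF True] m by auto
    next
      case False
      have "p dvd q * k" using adm(3) m by simp
      then show ?thesis using False prime_p q(1) by (metis prime_dvd_mult_iff primes_dvd_imp_eq)
    qed
    then have k: "admissible k" using less.prems k0(1) m unfolding admissible_def by auto
    have IH: "odd_classified k" "even_classified k" using less.IH[OF k0(2) k] by blast+
    have const: "\<exists>c. (\<forall>j<q. \<Sum>\<^sub># (slice q k j A) = c) \<and> (c = 0 \<or> \<not> q dvd k)"
      if "unity_mset m A" "\<Sum>\<^sub># A = 0" for A
      using slices_sum_const[OF q(1) k0(1), of A "{#}"] that m by simp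
    have big: "p2 \<le> q" if "\<not> q dvd k" using adm(5)[OF q] that \<open>p dvd k\<close> by auto
    have oq: "odd q" using adm(6)[OF q(2)] .
    have O: "odd_classified m"
      unfolding odd_classified_def
    proof (intro allI impI)
      fix A assume A: "unity_mset m A" "\<Sum>\<^sub># A = 0" "odd (size A)" "size A < 2 * p + p2"
      obtain c where c: "\<And>j. j < q \<Longrightarrow> \<Sum>\<^sub># (slice q k j A) = c" "c = 0 \<or> \<not> q dvd k"
        using const[OF A(1,2)] by blast
      show "is_gon m A \<or> p dvd size A \<and> 3 * p \<le> size A"
      proof (cases "c = 0")
        case True
        then show ?thesis using c(1) by (intro odd_classified_vanishing_slices[OF less.prems m q(1) k IH A]) auto
      next
        case False
        then have nd: "\<not> q dvd k" using c(2) by blast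
        show ?thesis
          using odd_classified_nonvanishing_slices[OF q(1) oq big[OF nd] nd k IH(1) _ A(3,4) c(1) False] A(1) m by simp
      qed
    qed
    have "even_classified m"
      unfolding even_classified_def
    proof (intro allI impI)
      fix A assume A: "unity_mset m A" "\<Sum>\<^sub># A = 0" "even (size A)" "A \<noteq> {#}" "size A < 3 * p + p2"
      obtain c where c: "\<And>j. j < q \<Longrightarrow> \<Sum>\<^sub># (slice q k j A) = c" "c = 0 \<or> \<not> q dvd k"
        using const[OF A(1,2)] by blast
      show "is_two_gons m A \<or> p dvd size A \<and> 4 * p \<le> size A"
      proof (cases "c = 0")
        case True
        then show ?thesis using c(1) by (intro even_classified_vanishing_slices[OF less.prems m q(1) O k IH A]) auto
      next
        case False
        then have nd: "\<not> q dvd k" using c(2) by blast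
        show ?thesis
          using even_classified_nonvanishing_slices[OF q(1) oq big[OF nd] nd k IH _ A(3,5) c(1) False] A(1) m by simp
      qed
    qed
    with O show ?thesis by blast
  qed
qed

end

section \<open>Bent functions and autocorrelation\<close>

lemma bij_betw_bit_vec_Pow:
  "bij_betw (\<lambda>v::bit vec. {i. i < n \<and> v $ i = 1}) (carrier_vec n) (Pow {..<n})"
proof (rule bij_betwI[where g = "\<lambda>S. vec n (\<lambda>i. of_bool (i \<in> S))"])
  show "vec n (\<lambda>i. of_bool (i \<in> {i. i < n \<and> v $ i = 1})) = v" if "v \<in> carrier_vec n" for v :: "bit vec"
    using that by (intro eq_vecI) auto
qed auto

lemma finite_bit_carrier_vec [simp]: "finite (carrier_vec n :: bit vec set)"
  using bij_betw_finite[OF bij_betw_bit_vec_Pow, of n] by simp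

lemma card_bit_carrier_vec [simp]: "card (carrier_vec n :: bit vec set) = 2 ^ n"
  using bij_betw_same_card[OF bij_betw_bit_vec_Pow, of n] by (simp add: card_Pow)

lemma bit_vec_add_self: "x \<in> carrier_vec n \<Longrightarrow> (x :: bit vec) + x = 0\<^sub>v n"
  by (intro eq_vecI) auto

lemma bit_vec_add_cancel:
  assumes "x \<in> carrier_vec n" "a \<in> carrier_vec n"
  shows "(x :: bit vec) + (x + a) = a" "(a + x) + x = a"
proof -
  show "x + (x + a) = a" using assms by (simp add: bit_vec_add_self flip: assoc_add_vec)
  show "(a + x) + x = a" using assms by (simp add: bit_vec_add_self)
qed

lemma bij_betw_bit_vec_add:
  assumes "a \<in> carrier_vec n"
  shows "bij_betw (\<lambda>x::bit vec. x + a) (carrier_vec n) (carrier_vec n)"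
  by (rule bij_betwI[where g = "\<lambda>x. x + a"]) (use assms bit_vec_add_cancel in auto)

lemma bit_vec_nonzero_index:
  assumes "a \<in> carrier_vec n" "a \<noteq> 0\<^sub>v n"
  obtains i where "i < n" "(a :: bit vec) $ i = 1"
  using assms by (auto simp: vec_eq_iff)

definition bit_sign :: "bit \<Rightarrow> complex" where
  "bit_sign b = (- 1) ^ of_bit b"

lemma bit_sign_add: "bit_sign (b + c) = bit_sign b * bit_sign c"
  by (cases "odd b"; cases "odd c") (simp_all add: bit_sign_def)

lemma bit_sign_simps [simp]: "bit_sign 0 = 1" "bit_sign 1 = - 1" "cnj (bit_sign b) = bit_sign b"
  by (simp_all add: bit_sign_def)

text \<open>Translation by a unit vector at a coordinate where \<open>a\<close> is 1 flips every
  sign.\<close>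

lemma sum_bit_sign:
  assumes a: "a \<in> carrier_vec n" "a \<noteq> 0\<^sub>v n"
  shows "(\<Sum>y\<in>carrier_vec n. bit_sign (y \<bullet> a)) = 0"
proof -
  obtain i where i: "i < n" "a $ i = 1" using bit_vec_nonzero_index[OF a] .
  let ?e = "unit_vec n i :: bit vec"
  have "(\<Sum>y\<in>carrier_vec n. bit_sign (y \<bullet> a)) = (\<Sum>y\<in>carrier_vec n. bit_sign ((y + ?e) \<bullet> a))"
    by (rule sum.reindex_bij_betw[OF bij_betw_bit_vec_add, symmetric]) simp
  also have "\<dots> = (\<Sum>y\<in>carrier_vec n. - bit_sign (y \<bullet> a))"
    by (intro sum.cong refl)
      (use i a in \<open>simp add: add_scalar_prod_distrib[of _ n] scalar_prod_left_unit bit_sign_add\<close>)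
  finally show ?thesis by (simp add: sum_negf)
qed

text \<open>For values of norm 1 the quotient equals \<open>w x * cnj (w (x + a))\<close>. As a
  quotient it is visibly a root of unity and compatible with powers.\<close>

definition autocorrelation :: "nat \<Rightarrow> (bit vec \<Rightarrow> complex) \<Rightarrow> bit vec \<Rightarrow> complex" where
  "autocorrelation n w a = (\<Sum>x\<in>carrier_vec n. w x / w (x + a))"

text \<open>The power spectrum is the Fourier transform of the autocorrelation: substitute z = x + a
  in the double sum.\<close>

lemma fourier_autocorrelation:
  assumes w: "\<And>x. x \<in> carrier_vec n \<Longrightarrow> norm (w x) = 1" and y: "y \<in> carrier_vec n"
  shows "of_real ((cmod (\<Sum>x\<in>carrier_vec n. w x * bit_sign (y \<bullet> x)))\<^sup>2) =
    (\<Sum>a\<in>carrier_vec n. bit_sign (y \<bullet> a) * autocorrelation n w a)"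
proof -
  let ?V = "carrier_vec n :: bit vec set"
  have cnj_w: "cnj (w x) = 1 / w x" if "x \<in> ?V" for x
    using w[OF that] by (auto simp: divide_conv_cnj)
  have "of_real ((cmod (\<Sum>x\<in>?V. w x * bit_sign (y \<bullet> x)))\<^sup>2) =
      (\<Sum>x\<in>?V. w x * bit_sign (y \<bullet> x)) * (\<Sum>z\<in>?V. cnj (w z) * bit_sign (y \<bullet> z))"
    by (simp add: complex_norm_square del: of_real_power)
  also have "\<dots> = (\<Sum>x\<in>?V. \<Sum>z\<in>?V. w x * cnj (w z) * bit_sign (y \<bullet> x + y \<bullet> z))"
    by (simp add: sum_product bit_sign_add mult_ac del: add_bit_eq_xor)
  also have "\<dots> = (\<Sum>x\<in>?V. \<Sum>a\<in>?V. w x * cnj (w (x + a)) * bit_sign (y \<bullet> x + y \<bullet> (x + a)))"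
  proof (rule sum.cong[OF refl])
    fix x assume x: "x \<in> ?V"
    have "bij_betw (\<lambda>a. x + a) ?V ?V"
      using bij_betw_bit_vec_add[OF x] x by (subst bij_betw_cong[of _ _ "\<lambda>a. a + x"]) (auto intro: comm_add_vec)
    from sum.reindex_bij_betw[OF this, of "\<lambda>z. w x * cnj (w z) * bit_sign (y \<bullet> x + y \<bullet> z)"]
    show "(\<Sum>z\<in>?V. w x * cnj (w z) * bit_sign (y \<bullet> x + y \<bullet> z)) =
      (\<Sum>a\<in>?V. w x * cnj (w (x + a)) * bit_sign (y \<bullet> x + y \<bullet> (x + a)))" by (rule sym)
  qed
  also have "\<dots> = (\<Sum>x\<in>?V. \<Sum>a\<in>?V. bit_sign (y \<bullet> a) * (w x / w (x + a)))"
  proof (intro sum.cong refl)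
    fix x a assume x: "x \<in> ?V" and a: "a \<in> ?V"
    have "y \<bullet> x + y \<bullet> (x + a) = y \<bullet> a"
      using x a y bit_vec_add_cancel(1)[OF x a] by (simp flip: scalar_prod_add_distrib[of _ n] del: add_bit_eq_xor)
    then show "w x * cnj (w (x + a)) * bit_sign (y \<bullet> x + y \<bullet> (x + a)) = bit_sign (y \<bullet> a) * (w x / w (x + a))"
      using cnj_w[of "x + a"] x a by simp
  qed
  also have "\<dots> = (\<Sum>a\<in>?V. bit_sign (y \<bullet> a) * autocorrelation n w a)"
    by (subst sum.swap) (simp add: autocorrelation_def sum_distrib_left)
  finally show ?thesis .
qed

text \<open>By Fourier inversion a constant spectrum belongs to an autocorrelation concentrated at
  zero, where its value is always \<open>2 ^ n\<close>.\<close>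

lemma flat_spectrum_iff_autocorrelation:
  assumes w: "\<And>x. x \<in> carrier_vec n \<Longrightarrow> norm (w x) = 1"
  shows "(\<forall>y\<in>carrier_vec n. (cmod (\<Sum>x\<in>carrier_vec n. w x * bit_sign (y \<bullet> x)))\<^sup>2 = 2 ^ n) \<longleftrightarrow>
    (\<forall>a\<in>carrier_vec n. a \<noteq> 0\<^sub>v n \<longrightarrow> autocorrelation n w a = 0)" (is "?L \<longleftrightarrow> ?R")
proof
  let ?V = "carrier_vec n :: bit vec set"
  assume L: ?L
  have flat: "(\<Sum>a\<in>?V. bit_sign (y \<bullet> a) * autocorrelation n w a) = 2 ^ n" if "y \<in> ?V" for y
  proof -
    have "(\<Sum>a\<in>?V. bit_sign (y \<bullet> a) * autocorrelation n w a) = of_real (2 ^ n)"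
      using fourier_autocorrelation[of n w y, OF w that] unfolding bspec[OF L that] by simp
    then show ?thesis by simp
  qed
  show ?R
  proof (intro ballI impI)
    fix b assume b: "b \<in> ?V" "b \<noteq> 0\<^sub>v n"
    have "0 = (\<Sum>y\<in>?V. bit_sign (y \<bullet> b) * 2 ^ n)"
      using sum_bit_sign[OF b] by (simp flip: sum_distrib_right)
    also have "\<dots> = (\<Sum>y\<in>?V. bit_sign (y \<bullet> b) * (\<Sum>a\<in>?V. bit_sign (y \<bullet> a) * autocorrelation n w a))"
      using flat by simp
    also have "\<dots> = (\<Sum>a\<in>?V. \<Sum>y\<in>?V. bit_sign (y \<bullet> (a + b)) * autocorrelation n w a)"
      unfolding sum_distrib_left
      by (subst sum.swap) (use b in \<open>simp add: scalar_prod_add_distrib[of _ n] bit_sign_add mult_ac del: add_bit_eq_xor\<close>)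
    also have "\<dots> = (\<Sum>a\<in>?V. if a = b then 2 ^ n * autocorrelation n w a else 0)"
    proof (intro sum.cong refl)
      fix a assume a: "a \<in> ?V"
      show "(\<Sum>y\<in>?V. bit_sign (y \<bullet> (a + b)) * autocorrelation n w a) = (if a = b then 2 ^ n * autocorrelation n w a else 0)"
      proof (cases "a = b")
        case True
        then show ?thesis using b by (simp add: bit_vec_add_self scalar_prod_right_zero)
      next
        case False
        have "a + b \<noteq> 0\<^sub>v n"
        proof
          assume "a + b = 0\<^sub>v n"
          then have "0\<^sub>v n + b = a" using bit_vec_add_cancel(2)[OF b(1) a] by simp
          then show False using False b by simp
        qed
        then have "(\<Sum>y\<in>?V. bit_sign (y \<bullet> (a + b))) = 0" using a b by (intro sum_bit_sign) auto
        then show ?thesis using False by (simp flip: sum_distrib_right)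
      qed
    qed
    also have "\<dots> = 2 ^ n * autocorrelation n w b" using b by simp
    finally show "autocorrelation n w b = 0" by simp
  qed
next
  let ?V = "carrier_vec n :: bit vec set"
  assume R: ?R
  have w0: "w x \<noteq> 0" if "x \<in> ?V" for x using w[OF that] by auto
  show ?L
  proof
    fix y assume y: "y \<in> ?V"
    have "(\<Sum>a\<in>?V. bit_sign (y \<bullet> a) * autocorrelation n w a) =
        (\<Sum>a\<in>?V. if a = 0\<^sub>v n then autocorrelation n w a else 0)"
      by (intro sum.cong refl) (use R y in \<open>auto simp: scalar_prod_right_zero\<close>)
    also have "\<dots> = autocorrelation n w (0\<^sub>v n)" by simp
    also have "\<dots> = (\<Sum>x\<in>?V. 1)" unfolding autocorrelation_def by (intro sum.cong) (use w0 in auto)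
    also have "\<dots> = of_real (2 ^ n)" by simp
    finally show "(cmod (\<Sum>x\<in>?V. w x * bit_sign (y \<bullet> x)))\<^sup>2 = 2 ^ n"
      using fourier_autocorrelation[of n w y, OF w y] by (simp only: of_real_eq_iff)
  qed
qed

text \<open>Values are roots of unity instead of exponents, so that changing the order means taking
  powers.\<close>

definition bent_sequence :: "nat \<Rightarrow> nat \<Rightarrow> (bit vec \<Rightarrow> complex) \<Rightarrow> bool" where
  "bent_sequence m n w \<longleftrightarrow> (\<forall>x\<in>carrier_vec n. w x ^ m = 1) \<and>
     (\<forall>a\<in>carrier_vec n. a \<noteq> 0\<^sub>v n \<longrightarrow> autocorrelation n w a = 0)"

lemma root_of_unity_norm: "m > 0 \<Longrightarrow> (z::complex) ^ m = 1 \<Longrightarrow> norm z = 1"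
  by (metis power_eq_1_iff zero_less_iff_neq_zero)

lemma ex_is_gbf_iff_bent_sequence:
  assumes m: "m > 0"
  shows "(\<exists>f. is_gbf m n f) \<longleftrightarrow> (\<exists>w. bent_sequence m n w)"
proof
  assume "\<exists>f. is_gbf m n f"
  then obtain f where f: "is_gbf m n f" by blast
  define w where "w x = zeta m ^ f x" for x
  have "zeta m = cis (2 * pi / m)"
    by (simp add: zeta_def cis_conv_exp mult_ac)
  then have "zeta m ^ m = 1" using m by (simp add: DeMoivre)
  then have wm: "w x ^ m = 1" for x unfolding w_def by (metis mult.commute power_mult power_one)
  have "\<forall>y\<in>carrier_vec n. (cmod (\<Sum>x\<in>carrier_vec n. w x * bit_sign (y \<bullet> x)))\<^sup>2 = 2 ^ n"
    using f unfolding is_gbf_def gbf_transform_def w_def bit_sign_def by blast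
  then have "bent_sequence m n w"
    using flat_spectrum_iff_autocorrelation[of n w] wm root_of_unity_norm[OF m] unfolding bent_sequence_def by blast
  then show "\<exists>w. bent_sequence m n w" by blast
next
  assume "\<exists>w. bent_sequence m n w"
  then obtain w where w: "bent_sequence m n w" by blast
  have "\<exists>k<m. zeta m ^ k = w x" if "x \<in> carrier_vec n" for x
  proof -
    have "w x \<in> (\<lambda>k. cis (2 * pi * real k / real m)) ` {..<m}"
      using bij_betw_roots_unity[OF m] w that by (auto simp: bij_betw_def bent_sequence_def)
    moreover have "cis (2 * pi * real k / real m) = zeta m ^ k" for k
      by (simp add: zeta_def cis_conv_exp flip: exp_of_nat_mult) (simp add: mult_ac)
    ultimately show ?thesis by auto
  qed
  then obtain f where f: "\<And>x. x \<in> carrier_vec n \<Longrightarrow> f x < m \<and> zeta m ^ f x = w x" by metis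
  have nrm: "norm (w x) = 1" if "x \<in> carrier_vec n" for x
    using w that root_of_unity_norm[OF m] unfolding bent_sequence_def by blast
  have "gbf_transform m n f y = (\<Sum>x\<in>carrier_vec n. w x * bit_sign (y \<bullet> x))" for y
    unfolding gbf_transform_def bit_sign_def by (intro sum.cong) (use f in auto)
  moreover have "\<forall>y\<in>carrier_vec n. (cmod (\<Sum>x\<in>carrier_vec n. w x * bit_sign (y \<bullet> x)))\<^sup>2 = 2 ^ n"
    using flat_spectrum_iff_autocorrelation[of n w, OF nrm] w unfolding bent_sequence_def by blast
  ultimately have "is_gbf m n f" using f unfolding is_gbf_def by auto
  then show "\<exists>f. is_gbf m n f" by blast
qed

section \<open>Ratios and their symmetry under inversion\<close>

definition ratios :: "nat \<Rightarrow> (bit vec \<Rightarrow> complex) \<Rightarrow> bit vec \<Rightarrow> complex multiset" where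
  "ratios n w a = image_mset (\<lambda>x. w x / w (x + a)) (mset_set (carrier_vec n))"

text \<open>Stronger than invariance under inversion: the fixed points 1 and -1 get even
  multiplicity. So the size is even, also that of slice 0, which inherits the property.\<close>

definition inverse_symmetric :: "complex multiset \<Rightarrow> bool" where
  "inverse_symmetric A \<longleftrightarrow> (\<exists>H. A = H + image_mset inverse H)"

lemma sum_ratios: "\<Sum>\<^sub># (ratios n w a) = autocorrelation n w a"
  by (simp add: ratios_def autocorrelation_def sum_unfold_sum_mset)

lemma size_ratios [simp]: "size (ratios n w a) = 2 ^ n"
  by (simp add: ratios_def)

lemma unity_mset_ratios:
  assumes "\<And>x. x \<in> carrier_vec n \<Longrightarrow> w x ^ m = 1" "a \<in> carrier_vec n"
  shows "unity_mset m (ratios n w a)"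
  using assms by (auto simp: unity_mset_def ratios_def power_divide)

text \<open>The ratios at \<open>x\<close> and \<open>x + a\<close> are inverse to each other; a
  coordinate where \<open>a\<close> is 1 picks one element of each such pair.\<close>

lemma inverse_symmetric_ratios:
  assumes a: "a \<in> carrier_vec n" "a \<noteq> 0\<^sub>v n"
  shows "inverse_symmetric (ratios n w a)"
proof -
  obtain i where i: "i < n" "a $ i = 1" using bit_vec_nonzero_index[OF a] .
  define S where "S b = {x \<in> carrier_vec n. x $ i = (b :: bit)}" for b
  have S: "finite (S b)" for b unfolding S_def by simp
  have split: "carrier_vec n = S 0 \<union> S 1" "S 0 \<inter> S 1 = {}" unfolding S_def by auto
  have sub: "x + a \<in> S (b + 1)" if "x \<in> S b" for x b using that i a unfolding S_def by auto
  have "bij_betw (\<lambda>x. x + a) (S 0) (S 1)"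
    by (rule bij_betwI[where g = "\<lambda>x. x + a"])
      (use sub[of _ 0] sub[of _ 1] bit_vec_add_cancel(2)[OF a(1)] in \<open>auto simp: S_def\<close>)
  then have "mset_set (S 1) = image_mset (\<lambda>x. x + a) (mset_set (S 0))"
    by (simp add: bij_betw_def image_mset_mset_set)
  moreover have "ratios n w a = image_mset (\<lambda>x. w x / w (x + a)) (mset_set (S 0)) + image_mset (\<lambda>x. w x / w (x + a)) (mset_set (S 1))"
    unfolding ratios_def split(1) by (simp add: mset_set_Union S split(2))
  moreover have "image_mset (\<lambda>x. w (x + a) / w (x + a + a)) (mset_set (S 0)) =
      image_mset (\<lambda>x. inverse (w x / w (x + a))) (mset_set (S 0))"
    by (intro image_mset_cong) (use S bit_vec_add_cancel(2)[OF a(1)] in \<open>auto simp: S_def\<close>)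
  ultimately have "ratios n w a = image_mset (\<lambda>x. w x / w (x + a)) (mset_set (S 0))
      + image_mset inverse (image_mset (\<lambda>x. w x / w (x + a)) (mset_set (S 0)))"
    by (simp add: image_mset.compositionality o_def)
  then show ?thesis unfolding inverse_symmetric_def by blast
qed

section \<open>Nonexistence of generalized bent functions\<close>

text \<open>With fewer than \<open>q\<close> terms some slice is empty, so all slices vanish; this
  repeats down to order \<open>k\<close>, where \<open>t\<close> acts trivially. Galois conjugation
  does not cover this: the \<open>t\<close> to be used is a multiple of
  \<open>q ^ e\<close>.\<close>

lemma sum_conjugate_small:
  fixes t :: nat
  assumes q: "prime q" and k: "k > 0" and t: "[t = 1] (mod k)"
    and A: "unity_mset (q ^ e * k) A" "\<Sum>\<^sub># A = 0" "size A < q"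
  shows "(\<Sum>z\<in>#A. z ^ t) = 0"
  using A
proof (induction e arbitrary: A)
  case 0
  have "z ^ t = z" if "z \<in># A" for z
    using 0(1) that t unfolding unity_mset_def cong_def by (metis mult_1 power_0 power_one_right root_of_unity_power_mod)
  then have "image_mset (\<lambda>z. z ^ t) A = image_mset (\<lambda>z. z) A" by (intro image_mset_cong)
  then show ?case using 0(2) by simp
next
  case (Suc e)
  define k' where "k' = q ^ e * k"
  have k': "k' > 0" using k prime_gt_0_nat[OF q] by (simp add: k'_def)
  have u: "unity_mset (q * k') A" using Suc.prems(1) by (simp add: k'_def mult.assoc)
  have sz: "size A = (\<Sum>j<q. size (slice q k' j A))" by (rule size_eq_slices[OF q k' u])
  obtain c where c: "\<And>j. j < q \<Longrightarrow> \<Sum>\<^sub># (slice q k' j A) = c"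
    using slices_sum_const[OF q k' u, of "{#}"] Suc.prems(2) by auto
  have "c = 0"
  proof (rule ccontr)
    assume "c \<noteq> 0"
    then have "size (slice q k' j A) \<ge> 1" if "j < q" for j
      using c[OF that] by (cases "slice q k' j A = {#}") (auto simp: Suc_le_eq nonempty_has_size)
    then show False using sum_mono[of "{..<q}" "\<lambda>_. 1" "\<lambda>j. size (slice q k' j A)"] sz Suc.prems(3) by simp
  qed
  have "(\<Sum>u\<in>#slice q k' j A. u ^ t) = 0" if j: "j < q" for j
  proof (rule Suc.IH)
    show "unity_mset (q ^ e * k) (slice q k' j A)" using unity_mset_slice[of k' q j A] by (simp add: k'_def)
    show "\<Sum>\<^sub># (slice q k' j A) = 0" using c[OF j] \<open>c = 0\<close> by simp
    show "size (slice q k' j A) < q"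
      using sum_ge_single[OF j, of 0 "\<lambda>j. size (slice q k' j A)"] sz Suc.prems(3) by simp
  qed
  then show ?case unfolding sum_slices_power[OF q k' u] by simp
qed

lemma size_filter_disjoint:
  assumes "\<And>z. P z \<Longrightarrow> \<not> Q z"
  shows "size (filter_mset P A) + size (filter_mset Q A) \<le> size A"
  by (induction A) (use assms in auto)

lemma even_size_inverse_symmetric: "inverse_symmetric A \<Longrightarrow> even (size A)"
  by (auto simp: inverse_symmetric_def)

lemma inverse_symmetric_slice_0:
  assumes "inverse_symmetric A"
  shows "inverse_symmetric (slice q k 0 A)"
proof -
  obtain H where H: "A = H + image_mset inverse H" using assms unfolding inverse_symmetric_def by blast
  have "slice q k 0 A = filter_mset (\<lambda>z. z ^ k = 1) H + image_mset inverse (filter_mset (\<lambda>z. z ^ k = 1) H)"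
    by (simp add: slice_def H filter_mset_image_mset power_inverse)
  then show ?thesis unfolding inverse_symmetric_def by blast
qed

text \<open>The classes of \<open>z\<close> and of \<open>inverse z\<close> are disjoint and equally large.\<close>

lemma size_slice_inverse_symmetric:
  assumes q: "prime q" "odd q" and k: "k > 0" and A: "inverse_symmetric A" and j: "j < q" "j \<noteq> 0"
  shows "2 * size (slice q k j A) \<le> size A"
proof -
  obtain H where H: "A = H + image_mset inverse H" using A unfolding inverse_symmetric_def by blast
  define w where "w = coset_rep q k j ^ k"
  have w0: "w \<noteq> 0" by (simp add: w_def)
  have "w \<noteq> coset_rep q k 0 ^ k"
    using coset_rep_power_bij[OF q(1) k] j unfolding w_def bij_betw_def inj_on_def by (metis lessThan_iff not_gr_zero less_trans)
  then have w1: "w \<noteq> 1" by simp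
  have wq: "w ^ q = 1" using coset_rep_power_bij[OF q(1) k] j unfolding w_def bij_betw_def by auto
  have cls: "(z / coset_rep q k j) ^ k = 1 \<longleftrightarrow> z ^ k = w" for z
    by (simp add: power_divide w_def)
  have inv: "inverse z ^ k = w \<longleftrightarrow> z ^ k = inverse w" for z
    by (metis inverse_inverse_eq power_inverse)
  have "size (slice q k j A) = size (filter_mset (\<lambda>z. z ^ k = w) H) + size (filter_mset (\<lambda>z. z ^ k = inverse w) H)"
    by (simp add: slice_def cls H filter_mset_image_mset inv)
  also have "\<dots> \<le> size H"
  proof (rule size_filter_disjoint)
    fix z assume z: "z ^ k = w"
    show "z ^ k \<noteq> inverse w"
    proof
      assume "z ^ k = inverse w"
      then have "w ^ 2 = 1" using z w0 by (simp add: power2_eq_square field_simps)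
      then have "w = 1" using root_of_unity_coprime[OF _ wq] q(2) by (simp add: coprime_left_2_iff_odd)
      then show False using w1 by simp
    qed
  qed
  finally show ?thesis by (simp add: H)
qed

text \<open>Each slice other than slice 0 has at most half of the terms, so fewer than
  \<open>q\<close>, and \<open>sum_conjugate_small\<close> applies; slice 0 is again symmetric and
  goes by induction.\<close>

lemma sum_conjugate_symmetric:
  fixes t :: nat
  assumes q: "prime q" "odd q" "p \<le> q" and p: "odd p" "p \<ge> 3"
    and k: "k > 0" "odd k" "\<And>r. prime r \<Longrightarrow> r dvd k \<Longrightarrow> r \<ge> p" and t: "[t = 1] (mod k)"
    and A: "unity_mset (q ^ e * k) A" "\<Sum>\<^sub># A = 0" "inverse_symmetric A" "size A < p + q"
  shows "(\<Sum>z\<in>#A. z ^ t) = 0"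
  using A
proof (induction e arbitrary: A)
  case 0
  have "z ^ t = z" if "z \<in># A" for z
    using 0(1) that t unfolding unity_mset_def cong_def by (metis mult_1 power_0 power_one_right root_of_unity_power_mod)
  then have "image_mset (\<lambda>z. z ^ t) A = image_mset (\<lambda>z. z) A" by (intro image_mset_cong)
  then show ?case using 0(2) by simp
next
  case (Suc e)
  define k' where "k' = q ^ e * k"
  have k': "k' > 0" "odd k'" using k q prime_gt_0_nat[of q] by (simp_all add: k'_def)
  have k'p: "r \<ge> p" if "prime r" "r dvd k'" for r
  proof -
    have "r dvd q ^ e \<or> r dvd k" using that by (simp add: k'_def prime_dvd_mult_iff)
    then show ?thesis
    proof
      assume "r dvd q ^ e"
      then have "r = q" using that(1) q(1) by (metis prime_dvd_power primes_dvd_imp_eq)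
      then show ?thesis using q(3) by simp
    qed (use k(3) that in blast)
  qed
  have u: "unity_mset (q * k') A" using Suc.prems(1) by (simp add: k'_def mult.assoc)
  define n where "n j = size (slice q k' j A)" for j
  have sz: "size A = (\<Sum>j<q. n j)" unfolding n_def by (rule size_eq_slices[OF q(1) k'(1) u])
  have q0: "0 < q" by (rule prime_gt_0_nat[OF q(1)])
  obtain c where c: "\<And>j. j < q \<Longrightarrow> \<Sum>\<^sub># (slice q k' j A) = c"
    using slices_sum_const[OF q(1) k'(1) u, of "{#}"] Suc.prems(2) by auto
  have sym0: "inverse_symmetric (slice q k' 0 A)" by (rule inverse_symmetric_slice_0[OF Suc.prems(3)])
  have le: "n j \<le> size A" if "j < q" for j using sum_ge_single[OF that, of 0 n] sz by simp
  have "c = 0"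
  proof (rule ccontr)
    assume "c \<noteq> 0"
    then have ne: "slice q k' j A \<noteq> {#}" if "j < q" for j using c[OF that] by auto
    then have n1: "n j \<ge> 1" if "j < q" for j using that by (simp add: n_def Suc_le_eq nonempty_has_size)
    show False
    proof (cases "\<exists>j<q. n j = 1")
      case True
      then obtain j where j: "j < q" "n j = 1" by blast
      \<comment> \<open>A slice with one term and the even slice 0 form an odd relation with at
        least \<open>p + 2\<close> terms; the remaining \<open>q - 2\<close> slices bring the total
        to \<open>p + q\<close>.\<close>
      have ev: "even (n 0)" using even_size_inverse_symmetric[OF sym0] by (simp add: n_def)
      then have "j \<noteq> 0" using j(2) by (metis odd_one)
      have "n 0 + n j \<ge> p + 2"
        using odd_relation_size[OF k' k'p p, of "slice q k' 0 A" "slice q k' j A"] unity_mset_slice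
          c[OF q0] c[OF j(1)] ne[OF q0] ne[OF j(1)] ev j(2) by (simp add: n_def)
      then show False
        using sum_ge_pair[OF q0 j(1), of 1 n] \<open>j \<noteq> 0\<close> n1 sz Suc.prems(4) by simp
    next
      case False
      have "n j \<ge> 2" if "j < q" for j
      proof -
        have "n j \<noteq> 1" using False that by blast
        then show ?thesis using n1[OF that] by linarith
      qed
      then have "(\<Sum>j<q. n j) \<ge> q * 2" using sum_mono[of "{..<q}" "\<lambda>_. 2" n] by simp
      then show False using sz Suc.prems(4) q(3) by linarith
    qed
  qed
  have "(\<Sum>u\<in>#slice q k' j A. u ^ t) = 0" if j: "j < q" for j
  proof (cases "j = 0")
    case True
    then show ?thesis
      using le[OF j] sym0 c[OF j] \<open>c = 0\<close> Suc.prems(4) unity_mset_slice[of k' q 0 A]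
      by (intro Suc.IH) (auto simp: k'_def n_def)
  next
    case False
    have "2 * n j \<le> size A"
      unfolding n_def by (rule size_slice_inverse_symmetric[OF q(1,2) k'(1) Suc.prems(3) j False])
    then show ?thesis
      using c[OF j] \<open>c = 0\<close> Suc.prems(4) q(3) unity_mset_slice[of k' q j A]
      by (intro sum_conjugate_small[OF q(1) k(1) t, of e]) (auto simp: k'_def n_def)
  qed
  then show ?case unfolding sum_slices_power[OF q(1) k'(1) u] by simp
qed

text \<open>Raising to the power \<open>t\<close> projects the roots of unity of order
  \<open>q ^ e * k\<close> onto their part of order \<open>k\<close>, and the sums of ratios stay
  zero.\<close>

theorem bent_sequence_remove_prime:
  assumes q: "prime q" "odd q" "p \<le> q" "\<not> q dvd k" and p: "odd p" "p \<ge> 3"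
    and k: "k > 0" "odd k" "\<And>r. prime r \<Longrightarrow> r dvd k \<Longrightarrow> r \<ge> p"
    and n: "2 ^ n < p + q" and w: "bent_sequence (q ^ e * k) n w"
  shows "\<exists>w. bent_sequence k n w"
proof -
  have "coprime (q ^ e) k" using q(1,4) by (simp add: prime_imp_coprime coprime_power_left_iff)
  then obtain t where t: "[t = 0] (mod (q ^ e))" "[t = 1] (mod k)"
    using binary_chinese_remainder_nat by blast
  obtain s where s: "t = q ^ e * s" using t(1) by (auto simp: cong_0_iff)
  have wm: "w x ^ (q ^ e * k) = 1" if "x \<in> carrier_vec n" for x
    using w that by (simp add: bent_sequence_def)
  have "(w x ^ t) ^ k = 1" if "x \<in> carrier_vec n" for x
  proof -
    have "(w x ^ t) ^ k = (w x ^ (q ^ e * k)) ^ s" unfolding s by (simp only: mult_ac flip: power_mult)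
    then show ?thesis using wm[OF that] by simp
  qed
  moreover have "autocorrelation n (\<lambda>x. w x ^ t) a = 0" if a: "a \<in> carrier_vec n" "a \<noteq> 0\<^sub>v n" for a
  proof -
    have "(\<Sum>z\<in>#ratios n w a. z ^ t) = 0"
      using w a n sum_ratios[of n w a] unity_mset_ratios[OF wm a(1)] inverse_symmetric_ratios[OF a]
      by (intro sum_conjugate_symmetric[OF q(1-3) p k t(2), of e]) (auto simp: bent_sequence_def)
    also have "(\<Sum>z\<in>#ratios n w a. z ^ t) = \<Sum>\<^sub># (ratios n (\<lambda>x. w x ^ t) a)"
      by (simp add: ratios_def image_mset.compositionality o_def power_divide)
    finally show ?thesis using sum_ratios by simp
  qed
  ultimately have "bent_sequence k n (\<lambda>x. w x ^ t)" unfolding bent_sequence_def by blast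
  then show ?thesis by blast
qed

text \<open>A condition on ratios allows the values to lie in any one coset of the
  \<open>q ^ e\<close>-th roots of unity. By \<open>vanishing_prime_power_size\<close> the size
  \<open>2 ^ n\<close> would be a multiple of \<open>q\<close>.\<close>

lemma not_bent_if_ratios_prime_power:
  assumes "n \<ge> 1" "prime q" "odd q" "\<And>a. a \<in> carrier_vec n \<Longrightarrow> unity_mset (q ^ e) (ratios n w a)"
  shows "\<not> bent_sequence m n w"
proof
  assume w: "bent_sequence m n w"
  have a: "unit_vec n 0 \<in> carrier_vec n" "unit_vec n 0 \<noteq> (0\<^sub>v n :: bit vec)"
    using assms(1) by (auto simp: vec_eq_iff)
  then have "[size (ratios n w (unit_vec n 0)) = size ({#} :: complex multiset)] (mod q)"
    using w assms(4)[OF a(1)] sum_ratios[of n w "unit_vec n 0"]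
    by (intro vanishing_prime_power_size[OF assms(2), of e]) (auto simp: bent_sequence_def)
  then have "q dvd 2 ^ n" by (simp add: cong_0_iff)
  then have "q = 2" using assms(2) by (metis prime_dvd_power primes_dvd_imp_eq two_is_prime_nat)
  then show False using assms(3) by simp
qed

text \<open>Inversion preserves the union, so it contains the \<open>q1\<close>-gon through
  \<open>inverse g\<close>. The \<open>q2\<close>-gon has at most one of these vertices, so this is
  the \<open>q1\<close>-gon through \<open>g\<close>. Hence the square of \<open>g\<close> is a
  \<open>q1\<close>-th root of unity, and so is \<open>g\<close>, having odd order.\<close>

lemma two_gons_inverse_symmetric:
  assumes A: "gon g q1 + gon h q2 = A" "inverse_symmetric A" and q: "prime q1" "prime q2" "q1 \<noteq> q2" "q1 > 2"
    and gh: "g \<noteq> 0" "h \<noteq> 0" and m: "odd m" "g ^ m = 1" and z: "z \<in># gon g q1"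
  shows "z ^ q1 = 1"
proof -
  obtain H where H: "A = H + image_mset inverse H" using A(2) unfolding inverse_symmetric_def by blast
  let ?F = "filter_mset (\<lambda>z. (z / inverse g) ^ q1 = 1)"
  have "image_mset inverse A = A"
    by (simp add: H image_mset.compositionality o_def add.commute)
  moreover have inv_gon: "image_mset inverse (gon g q1) = gon (inverse g) q1"
  proof -
    have "inverse ` {z. (z / g) ^ q1 = 1} = {z. (z / inverse g) ^ q1 = 1}"
    proof (intro equalityI subsetI)
      fix x assume "x \<in> {z. (z / inverse g) ^ q1 = 1}"
      then have "(x * g) ^ q1 = 1" by (simp add: divide_inverse)
      then have "(inverse x / g) ^ q1 = 1" by (metis divide_inverse inverse_1 inverse_mult_distrib mult.commute power_inverse)
      then show "x \<in> inverse ` {z. (z / g) ^ q1 = 1}" by (intro image_eqI[of _ _ "inverse x"]) auto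
    next
      fix x assume "x \<in> inverse ` {z. (z / g) ^ q1 = 1}"
      then obtain y where "x = inverse y" "(y / g) ^ q1 = 1" by auto
      then show "x \<in> {z. (z / inverse g) ^ q1 = 1}"
        by (simp add: divide_inverse) (metis inverse_1 inverse_inverse_eq inverse_mult_distrib mult.commute power_inverse)
    qed
    then show ?thesis unfolding gon_def by (subst image_mset_mset_set) (auto simp: inj_on_def)
  qed
  ultimately have "gon (inverse g) q1 \<subseteq># gon g q1 + gon h q2"
    using A(1) by (metis image_mset_union mset_subset_eq_add_left)
  then have "size (?F (gon (inverse g) q1)) \<le> size (?F (gon g q1 + gon h q2))"
    by (intro size_mset_mono multiset_filter_mono)
  moreover have "?F (gon (inverse g) q1) = gon (inverse g) q1" using q gh by (intro filter_gon_self) auto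
  moreover have "size (?F (gon h q2)) \<le> 1" using q gh by (intro filter_gon_distinct_primes) auto
  ultimately have "?F (gon g q1) \<noteq> {#}" using q gh by (auto simp del: filter_mset_eq_mempty_iff)
  then have "gon g q1 = gon (inverse g) q1" using filter_gon_eq[of q1 "inverse g" g] q gh by simp
  moreover have "g \<in># gon g q1" using gh q by simp
  ultimately have "(g / inverse g) ^ q1 = 1" using gh q by simp
  then have "(g ^ q1) ^ 2 = 1" by (simp add: divide_inverse power_mult_distrib power2_eq_square)
  moreover have "(g ^ q1) ^ m = 1" using m(2) by (metis mult.commute power_mult power_one)
  ultimately have "g ^ q1 = 1" using root_of_unity_coprime[of "g ^ q1" 2 m] m(1) by (simp add: coprime_left_2_iff_odd)
  then show ?thesis using z gh q by (simp add: power_divide)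
qed

text \<open>For distinct primes the order of \<open>a / b\<close> would be \<open>q1 * q2\<close>,
  which does not divide a prime.\<close>

lemma prime_order_ratio:
  fixes a b :: complex
  assumes "prime q1" "prime q2" "prime q3" "a ^ q1 = 1" "b ^ q2 = 1" "(a / b) ^ q3 = 1" "a \<noteq> 1" "b \<noteq> 1"
  shows "q1 = q2"
proof (rule ccontr)
  assume ne: "q1 \<noteq> q2"
  have "b \<noteq> 0" using assms(2,5) prime_gt_0_nat[of q2] by (auto simp: power_0_left)
  then have eq: "a ^ q3 = b ^ q3" using assms(6) by (simp add: power_divide)
  show False
  proof (cases "q3 = q2")
    case True
    then have "a ^ q2 = 1" using eq assms(5) by simp
    then show False using root_of_unity_coprime[OF assms(4)] primes_coprime[OF assms(1,2) ne] assms(7) by blast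
  next
    case False
    have "b ^ (q3 * q1) = a ^ (q1 * q3)" using eq by (simp add: power_mult mult.commute[of q1])
    then have "b ^ (q3 * q1) = 1" using assms(4) by (simp add: power_mult)
    moreover have "coprime (q3 * q1) q2" using primes_coprime[OF assms(1,2) ne] primes_coprime[OF assms(3,2) False] by simp
    ultimately show False using root_of_unity_coprime assms(5,8) by blast
  qed
qed

theorem (in two_smallest_primes) not_bent_sequence:
  assumes m: "admissible m" and n: "n \<ge> 1" "2 ^ n < 3 * p + p2"
  shows "\<not> bent_sequence m n w"
proof
  assume w: "bent_sequence m n w"
  note adm = admissibleD[OF m]
  have wm: "w x ^ m = 1" if "x \<in> carrier_vec n" for x using w that by (simp add: bent_sequence_def)
  have w0: "w x \<noteq> 0" if "x \<in> carrier_vec n" for x using wm[OF that] adm(1) by (auto simp: power_0_left)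
  \<comment> \<open>Rules out the alternative with \<open>p\<close> dividing the size, and also two
    polygons with equally many vertices.\<close>
  have ndvd: "\<not> q dvd 2 ^ n" if "prime q" "odd q" for q :: nat
    using that by (metis prime_dvd_power primes_dvd_imp_eq two_is_prime_nat)
  have ratio: "\<exists>q. prime q \<and> q dvd m \<and> z ^ q = 1"
    if a: "a \<in> carrier_vec n" "a \<noteq> 0\<^sub>v n" and z: "z \<in># ratios n w a" for a z
  proof -
    let ?R = "ratios n w a"
    have u: "unity_mset m ?R" by (rule unity_mset_ratios[OF wm a(1)])
    have "?R \<noteq> {#}" using z by auto
    moreover have "\<Sum>\<^sub># ?R = 0" using w a sum_ratios unfolding bent_sequence_def by simp
    moreover have "even (size ?R)" using n(1) by simp
    ultimately have "is_two_gons m ?R"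
      using vanishing_sums_classified[OF m] u n(2) ndvd[OF prime_p odd_p] unfolding even_classified_def by (metis size_ratios)
    then obtain g h q1 q2 where R: "prime q1" "q1 dvd m" "g \<noteq> 0" "prime q2" "q2 dvd m" "h \<noteq> 0"
      "?R = gon g q1 + gon h q2" unfolding is_two_gons_def is_gon_def by blast
    have odd: "odd q1" "odd q2" using adm(6) R by blast+
    have pos: "q1 > 2" "q2 > 2" using odd R prime_ge_2_nat by (metis dvd_refl le_neq_implies_less)+
    have "size ?R = q1 + q2" unfolding R(7) using R pos by simp
    then have "2 ^ n = q1 + q2" by simp
    then have "q1 \<noteq> q2" using ndvd[OF R(1) odd(1)] by auto
    moreover have "g ^ m = 1" "h ^ m = 1"
    proof -
      have "g \<in># ?R" "h \<in># ?R" using R pos by auto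
      then show "g ^ m = 1" "h ^ m = 1" using u by (simp_all add: unity_mset_def)
    qed
    moreover have sym: "inverse_symmetric ?R" by (rule inverse_symmetric_ratios[OF a])
    ultimately have "z ^ q1 = 1 \<or> z ^ q2 = 1"
      using z R pos adm(2) two_gons_inverse_symmetric[of g q1 h q2 ?R m z] two_gons_inverse_symmetric[of h q2 g q1 ?R m z]
      by (auto simp: add.commute)
    then show ?thesis using R by blast
  qed
  have quot: "\<exists>q. prime q \<and> q dvd m \<and> (w x / w y) ^ q = 1" if xy: "x \<in> carrier_vec n" "y \<in> carrier_vec n" for x y
  proof (cases "x = y")
    case True
    then show ?thesis using w0[OF xy(1)] prime_p adm(3) by auto
  next
    case False
    have sum: "x + (x + y) = y" by (rule bit_vec_add_cancel(1)[OF xy])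
    have "x + y \<noteq> 0\<^sub>v n" using sum False xy by auto
    moreover have "w x / w y \<in># ratios n w (x + y)"
      using xy sum by (auto simp: ratios_def intro!: image_eqI[of _ _ x])
    ultimately show ?thesis using ratio[of "x + y"] xy by auto
  qed
  let ?o = "0\<^sub>v n :: bit vec"
  \<comment> \<open>A nontrivial quotient by the value at the origin fixes \<open>q\<close>. Any
    other has the same prime order, because the quotient of both is again a quotient of two values
    of \<open>w\<close>. If all values agree, \<open>p\<close> serves.\<close>
  obtain q where q: "prime q" "q dvd m" "\<And>x. x \<in> carrier_vec n \<Longrightarrow> (w x / w ?o) ^ q = 1"
  proof (cases "\<exists>x\<in>carrier_vec n. w x \<noteq> w ?o")
    case False
    then have eq: "w x = w ?o" if "x \<in> carrier_vec n" for x using that by blast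
    have "(w x / w ?o) ^ p = 1" if "x \<in> carrier_vec n" for x
      unfolding eq[OF that] using w0[of ?o] by simp
    then show thesis using that[OF prime_p adm(3)] by blast
  next
    case True
    then obtain x where x: "x \<in> carrier_vec n" "w x \<noteq> w ?o" by blast
    obtain q where q: "prime q" "q dvd m" "(w x / w ?o) ^ q = 1" using quot[OF x(1), of ?o] by auto
    have "(w y / w ?o) ^ q = 1" if y: "y \<in> carrier_vec n" for y
    proof (cases "w y = w ?o")
      case True
      then show ?thesis using w0[of ?o] by simp
    next
      case False
      obtain q2 where q2: "prime q2" "(w y / w ?o) ^ q2 = 1" using quot[OF y, of ?o] by auto
      obtain q3 where q3: "prime q3" "(w x / w y) ^ q3 = 1" using quot[OF x(1) y] by auto
      have "(w x / w ?o) / (w y / w ?o) = w x / w y" using w0[of ?o] by simp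
      then have "q = q2" using prime_order_ratio[OF q(1) q2(1) q3(1) q(3) q2(2)] q3(2) x(2) False w0[of ?o] by simp
      then show ?thesis using q2(2) by simp
    qed
    then show thesis using that q by blast
  qed
  have "unity_mset (q ^ 1) (ratios n w a)" if a: "a \<in> carrier_vec n" for a
  proof -
    have "(w x / w (x + a)) ^ q = 1" if x: "x \<in> carrier_vec n" for x
    proof -
      have "w x / w (x + a) = (w x / w ?o) / (w (x + a) / w ?o)" using w0[of ?o] by simp
      then show ?thesis using q(3)[OF x] q(3)[of "x + a"] x a by (simp only: power_divide) simp
    qed
    then show ?thesis by (auto simp: unity_mset_def ratios_def)
  qed
  then show False using not_bent_if_ratios_prime_power[OF n(1) q(1) adm(6)[OF q(2)], of 1 w m] w by blast
qed

section \<open>Assembling (a), (b) and (c)\<close>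

theorem corollary3p5:
  fixes n m s :: nat and p \<alpha> :: "nat \<Rightarrow> nat"
  assumes "n \<ge> 1" and "s \<ge> 1"
    and "\<And>i. i \<in> {1..s} \<Longrightarrow> prime (p i) \<and> odd (p i)"
    and "strict_mono_on {1..s} p"
    and "\<And>i. i \<in> {1..s} \<Longrightarrow> \<alpha> i > 0"
    and "m = (\<Prod>i=1..s. p i ^ \<alpha> i)"
  shows "(s = 1 \<longrightarrow> \<not> (\<exists>f. is_gbf m n f)) \<and>
    (s \<ge> 2 \<and> 3 * p 1 + p 2 > 2 ^ n \<longrightarrow> \<not> (\<exists>f. is_gbf m n f)) \<and>
    (\<forall>r. r + 1 \<in> {1..s} \<and> p 1 + p (r + 1) > 2 ^ n \<and>
        (\<forall>j\<in>{1..s}. p 1 + p j > 2 ^ n \<longrightarrow> p (r + 1) \<le> p j) \<and>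
        \<not> (\<exists>f. is_gbf (\<Prod>i=1..r. p i ^ \<alpha> i) n f)
      \<longrightarrow> \<not> (\<exists>f. is_gbf m n f))"
proof (intro conjI impI allI)
  define M where "M k = (\<Prod>i=1..k. p i ^ \<alpha> i)" for k
  have pr: "prime (p i)" "odd (p i)" if "i \<in> {1..s}" for i using assms(3)[OF that] by auto
  have mono: "p i \<le> p j" if "i \<in> {1..s}" "j \<in> {1..s}" "i \<le> j" for i j
    using that assms(4) by (cases "i = j") (auto simp: strict_mono_on_def less_imp_le)
  have smono: "p i < p j" if "i \<in> {1..s}" "j \<in> {1..s}" "i < j" for i j
    using that assms(4) by (auto simp: strict_mono_on_def)
  have p3: "p 1 \<ge> 3" using pr[of 1] assms(2) prime_ge_2_nat[of "p 1"] by (cases "p 1 = 2") auto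
  have M_pos: "M k > 0" if "k \<le> s" for k
    unfolding M_def using pr that by (intro prod_pos) (auto intro!: prime_gt_0_nat)
  have M_odd: "odd (M k)" if "k \<le> s" for k
    unfolding M_def using pr that by (auto simp: prime_dvd_prod_iff prime_dvd_power_iff even_prod_iff)
  have M_primes: "\<exists>i\<in>{1..k}. r = p i" if k: "k \<le> s" and r: "prime r" "r dvd M k" for k r
  proof -
    obtain i where i: "i \<in> {1..k}" "r dvd p i ^ \<alpha> i"
      using r unfolding M_def by (auto simp: prime_dvd_prod_iff)
    then have "r dvd p i" using r(1) prime_dvd_power by blast
    then have "r = p i" using k r(1) pr[of i] i(1) by (auto simp: primes_dvd_imp_eq)
    then show ?thesis using i(1) by blast
  qed
  have gbf: "(\<exists>f. is_gbf (M k) n f) \<longleftrightarrow> (\<exists>w. bent_sequence (M k) n w)" if "k \<le> s" for k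
    by (rule ex_is_gbf_iff_bent_sequence[OF M_pos[OF that]])
  have mM: "m = M s" using assms(6) by (simp add: M_def)
  {
    assume s: "s = 1"
    have "\<not> bent_sequence m n w" for w
    proof
      assume w: "bent_sequence m n w"
      have "unity_mset (p 1 ^ \<alpha> 1) (ratios n w a)" if "a \<in> carrier_vec n" for a
        using w that mM s by (intro unity_mset_ratios) (simp_all add: bent_sequence_def M_def)
      then show False using not_bent_if_ratios_prime_power[OF assms(1), of "p 1" "\<alpha> 1" w m] pr[of 1] s w by auto
    qed
    then show "\<not> (\<exists>f. is_gbf m n f)" using gbf[of s] mM by simp
  }
  {
    assume s: "s \<ge> 2 \<and> 3 * p 1 + p 2 > 2 ^ n"
    have "odd (p 1)" "odd (p 2)" "p 1 < p 2" using pr smono[of 1 2] s by auto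
    then have p2: "p 1 + 2 \<le> p 2" by presburger
    interpret two_smallest_primes "p 1" "p 2"
      by unfold_locales (use pr[of 1] s p2 in auto)
    have "p 1 dvd M s"
      unfolding M_def using assms(2,5) dvd_prodI[of "{1..s}" 1 "\<lambda>i. p i ^ \<alpha> i"] by (auto intro: dvd_trans[OF dvd_power])
    moreover have "q = p 1 \<or> p 2 \<le> q" if q: "prime q" "q dvd M s" for q
    proof -
      obtain i where i: "i \<in> {1..s}" "q = p i" using M_primes[OF order_refl q] by blast
      then show ?thesis using mono[of 2 i] s by (cases "i = 1") auto
    qed
    ultimately have "admissible (M s)" using M_pos M_odd unfolding admissible_def by blast
    then have "\<not> bent_sequence m n w" for w using not_bent_sequence[of "M s" n w] assms(1) s mM by auto
    then show "\<not> (\<exists>f. is_gbf m n f)" using gbf[of s] mM by simp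
  }
  {
    fix r
    assume r: "r + 1 \<in> {1..s} \<and> p 1 + p (r + 1) > 2 ^ n \<and>
        (\<forall>j\<in>{1..s}. p 1 + p j > 2 ^ n \<longrightarrow> p (r + 1) \<le> p j) \<and>
        \<not> (\<exists>f. is_gbf (\<Prod>i=1..r. p i ^ \<alpha> i) n f)"
    \<comment> \<open>The primes from index \<open>r + 1\<close> on are added one at a time; each is
      at least \<open>p (r + 1)\<close>, so the size condition persists. For \<open>r = 0\<close>
      the start is order 1.\<close>
    have "\<not> (\<exists>w. bent_sequence (M k) n w)" if "r \<le> k" "k \<le> s" for k
      using that
    proof (induction k rule: dec_induct)
      case base
      then show ?case using r gbf[of r] by (simp add: M_def)
    next
      case (step k)
      have k1: "Suc k \<in> {1..s}" using step by simp
      have "M (Suc k) = p (Suc k) ^ \<alpha> (Suc k) * M k" by (simp add: M_def)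
      moreover have nd: "\<not> p (Suc k) dvd M k"
      proof
        assume "p (Suc k) dvd M k"
        then obtain i where i: "i \<in> {1..k}" "p (Suc k) = p i"
          using M_primes[of k "p (Suc k)"] pr(1)[OF k1] step.prems by auto
        then have "p i < p (Suc k)" using k1 by (intro smono) auto
        then show False using i(2) by simp
      qed
      moreover have k_primes: "p 1 \<le> q" if q: "prime q" "q dvd M k" for q
      proof -
        obtain i where i: "i \<in> {1..k}" "q = p i" using M_primes[OF _ q] step.prems by auto
        then show ?thesis using step.prems mono[of 1 i] by auto
      qed
      moreover have le: "p (r + 1) \<le> p (Suc k)" "p 1 \<le> p (Suc k)"
        using r k1 step.hyps by (auto intro!: mono)
      moreover have "2 ^ n < p 1 + p (Suc k)" using le(1) r by linarith
      moreover have "odd (p 1)" using pr(2)[of 1] k1 by auto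
      moreover have "\<nexists>w. bent_sequence (M k) n w" using step by simp
      moreover have "M k > 0" "odd (M k)" using M_pos M_odd step.prems by auto
      ultimately show ?case
        using bent_sequence_remove_prime[OF pr[OF k1] le(2) nd _ p3 _ _ k_primes] by metis
    qed
    from this[of s] show "\<not> (\<exists>f. is_gbf m n f)" using gbf[of s] r mM by auto
  }
qed

end
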